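(* Assume we are given data $\{(x_n,y_n)\}_{n=1}^N\subseteq X\times\mathbb{R}^d$. Let $L\colon\mathbb{R}^d\times\mathbb{R}^d\to\mathbb{R}$ be such that for every $y\in\mathbb{R}^d$, the map $L(\cdot,y)$ is convex, coercive, and lower semicontinuous. Let $\mathcal{B}$ be a neural vv-RKBS of functions from compact $X\subseteq\mathbb{R}^{d_x}$ to $\mathbb{R}^d$ with weight space $\Omega\subseteq\mathbb{R}^{d_x}\times\mathbb{R}$ and $$\phi\in C_0(X\times\Omega),\qquad\phi(x,(\omega,b)):=\sigma(\langle\omega,x\rangle_{\ell_2}+b)\,\beta((\omega,b)),$$ for a measurable activation $\sigma\colon\mathbb{R}\to\mathbb{R}$ and a measurable positive $\beta\colon\Omega\to\mathbb{R}$. Then, for $\lambda\ge0$, there exists a solution to the supervised learning problem $$\min_{f\in\mathcal{B}}\ \frac1N\sum_{n=1}^N L(f(x_n),y_n)+\lambda\|f\|_{\mathcal{B}}$$ that admits a neural network representation $$f^\dagger(x)=(A_{\Omega\to X}\mu^\dagger)(x)=\sum_{m=1}^{Nd}\sigma(\langle\omega_m,x\rangle_{\ell_2}+b_m)\,u_m=U\sigma(Wx+B),$$ for some $\mu^\dagger\in\mathcal{M}(\Omega;\mathbb{R}^d)$, $(\omega_m,b_m)\in\Omega$, $u_m\in\mathbb{R}^d$, with $U\in\mathbb{R}^{d\times Nd}$ containing the $u_m$ as columns, $W\in\mathbb{R}^{Nd\times d_x}$ the $\omega_m$ as rows, $B\in\mathbb{R}^{Nd}$ the $b_m$ values, and $\sigma$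 applied componentwise.
   Context: All vector spaces are real. $\langle\cdot,\cdot\rangle_{\ell_2}$ is the Euclidean inner product on $\mathbb{R}^{d_x}$. $\mathbb{R}^d$ is the (finite-dimensional) Banach output space, equipped with some norm $\|\cdot\|$. For a Banach space $V$ and a locally compact Hausdorff space $\Omega$, $\mathcal{M}(\Omega;V)$ is the space of regular countably additive $V$-valued Borel vector measures of finite total variation; $|\mu|_V$ is the total variation measure. $C_0(\cdot)$ denotes continuous real functions vanishing at infinity. Neural vv-RKBS (in this setting): $X\subseteq\mathbb{R}^{d_x}$ is compact, $\widetilde\Omega\subseteq\mathbb{R}^{d_x}$ is locally compact Hausdorff, $\Omega=\widetilde\Omega\times\mathbb{R}$, $\phi$ is as in the statement, $(A_{\Omega\to X}\mu)(x):=\int_\Omega\phi(x,w)\,d\mu(w)$ for $\mu\in\mathcal{M}(\Omega;\mathbb{R}^d)$, and $$\mathcal{B}:=\{f=A_{\Omega\to X}\mu\mid\mu\in\mathcal{M}(\Omega;\mathbb{R}^d)\},\qquad\|f\|_{\mathcal{B}}:=\inf_{f=A_{\Omega\to X}\mu}|\mu|_{\mathbb{R}^d}(\Omega).$$ *)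

theory Defs
  imports "HOL-Analysis.Analysis"
begin

text \<open>
  The output space \<open>\<real>\<^sup>d\<close> carries an arbitrary norm, not necessarily the Euclidean norm that the
  library puts on \<open>real ^ 'd\<close>, so the norm is an explicit argument \<open>nrm\<close>. In finite dimensions all
  norms induce the same topology, hence the topological notions below (\<open>sums\<close>, \<open>\<longlonglongrightarrow>\<close>,
  \<open>at_infinity\<close>) are those of the library type; metric quantities use \<open>nrm\<close>.
\<close>

definition vector_norm :: "('v::real_vector \<Rightarrow> real) \<Rightarrow> bool" where
  "vector_norm nrm \<longleftrightarrow>
     (\<forall>v. 0 \<le> nrm v) \<and> (\<forall>v. nrm v = 0 \<longleftrightarrow> v = 0) \<and>
     (\<forall>c v. nrm (c *\<^sub>R v) = \<bar>c\<bar> * nrm v) \<and>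
     (\<forall>u v. nrm (u + v) \<le> nrm u + nrm v)"


subsection \<open>Functions\<close>

definition C0_on :: "'a::topological_space set \<Rightarrow> ('a \<Rightarrow> real) \<Rightarrow> bool" where
  "C0_on S f \<longleftrightarrow> continuous_on S f \<and>
     (\<forall>e>0. \<exists>K. compact K \<and> K \<subseteq> S \<and> (\<forall>p\<in>S - K. \<bar>f p\<bar> < e))"

definition lower_semicontinuous :: "('a::topological_space \<Rightarrow> real) \<Rightarrow> bool" where
  "lower_semicontinuous f \<longleftrightarrow> (\<forall>z. \<forall>t < f z. eventually (\<lambda>z'. t < f z') (nhds z))"

definition coercive :: "('a::real_normed_vector \<Rightarrow> real) \<Rightarrow> bool" where
  "coercive f \<longleftrightarrow> filterlim f at_top at_infinity"


subsection \<open>Vector measures\<close>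

text \<open>
  The Borel sigma-algebra of the subspace \<open>\<Omega>\<close> is \<open>sets (restrict_space borel \<Omega>)\<close>. A vector
  measure is a function on sets of which only the values on this sigma-algebra matter.
\<close>

abbreviation borel_of_subspace :: "'a::topological_space set \<Rightarrow> 'a measure" where
  "borel_of_subspace \<Omega> \<equiv> restrict_space borel \<Omega>"

definition countably_additive_vm ::
  "'a::topological_space set \<Rightarrow> ('a set \<Rightarrow> 'v::euclidean_space) \<Rightarrow> bool" where
  "countably_additive_vm \<Omega> \<mu> \<longleftrightarrow>
     (\<forall>A::nat \<Rightarrow> 'a set. range A \<subseteq> sets (borel_of_subspace \<Omega>) \<longrightarrow> disjoint_family A \<longrightarrow>
        (\<lambda>i. \<mu> (A i)) sums \<mu> (\<Union>i. A i))"

definition total_variation ::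
  "('v \<Rightarrow> real) \<Rightarrow> 'a::topological_space set \<Rightarrow> ('a set \<Rightarrow> 'v::euclidean_space) \<Rightarrow> 'a set \<Rightarrow> ennreal"
  where
  "total_variation nrm \<Omega> \<mu> E =
     (SUP P \<in> {P. finite P \<and> P \<subseteq> sets (borel_of_subspace \<Omega>) \<and> partition_on E P}.
        \<Sum>A\<in>P. ennreal (nrm (\<mu> A)))"

definition regular_vm ::
  "('v \<Rightarrow> real) \<Rightarrow> 'a::topological_space set \<Rightarrow> ('a set \<Rightarrow> 'v::euclidean_space) \<Rightarrow> bool" where
  "regular_vm nrm \<Omega> \<mu> \<longleftrightarrow>
     (\<forall>E\<in>sets (borel_of_subspace \<Omega>). \<forall>e>0. \<exists>K G. compact K \<and> openin (top_of_set \<Omega>) G \<and>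
        K \<subseteq> E \<and> E \<subseteq> G \<and> total_variation nrm \<Omega> \<mu> (G - K) < ennreal e)"

text \<open>The space \<open>\<M>(\<Omega>; V)\<close>, for \<open>V\<close> the type \<open>'v\<close> normed by \<open>nrm\<close>.\<close>

definition vector_measures ::
  "('v \<Rightarrow> real) \<Rightarrow> 'a::topological_space set \<Rightarrow> ('a set \<Rightarrow> 'v::euclidean_space) set" where
  "vector_measures nrm \<Omega> =
     {\<mu>. countably_additive_vm \<Omega> \<mu> \<and> regular_vm nrm \<Omega> \<mu> \<and> total_variation nrm \<Omega> \<mu> \<Omega> < \<infinity>}"

text \<open>
  The integral of a bounded measurable scalar function against a vector measure: the limit of the
  integrals of simple functions converging uniformly on \<open>\<Omega>\<close>.
\<close>

definition simple_vm_integral ::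
  "'a::topological_space set \<Rightarrow> ('a set \<Rightarrow> 'v::euclidean_space) \<Rightarrow> ('a \<Rightarrow> real) \<Rightarrow> 'v" where
  "simple_vm_integral \<Omega> \<mu> s = (\<Sum>c\<in>s ` \<Omega>. c *\<^sub>R \<mu> (s -` {c} \<inter> \<Omega>))"

definition has_vm_integral ::
  "'a::topological_space set \<Rightarrow> ('a set \<Rightarrow> 'v::euclidean_space) \<Rightarrow> ('a \<Rightarrow> real) \<Rightarrow> 'v \<Rightarrow> bool"
  where
  "has_vm_integral \<Omega> \<mu> f I \<longleftrightarrow>
     (\<exists>s::nat \<Rightarrow> 'a \<Rightarrow> real. (\<forall>k. simple_function (borel_of_subspace \<Omega>) (s k)) \<and>
        uniform_limit \<Omega> s f sequentially \<and>
        (\<lambda>k. simple_vm_integral \<Omega> \<mu> (s k)) \<longlonglongrightarrow> I)"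

definition vm_integral ::
  "'a::topological_space set \<Rightarrow> ('a set \<Rightarrow> 'v::euclidean_space) \<Rightarrow> ('a \<Rightarrow> real) \<Rightarrow> 'v" where
  "vm_integral \<Omega> \<mu> f = (THE I. has_vm_integral \<Omega> \<mu> f I)"


subsection \<open>Vector-valued reproducing kernel Banach spaces\<close>

text \<open>
  Functions on \<open>X\<close> are represented as \<open>extensional\<close> functions, so that equality of functions is
  equality on \<open>X\<close>.
\<close>

definition A_op ::
  "'x set \<Rightarrow> 'a::topological_space set \<Rightarrow> ('x \<Rightarrow> 'a \<Rightarrow> real) \<Rightarrow>
   ('a set \<Rightarrow> 'v::euclidean_space) \<Rightarrow> 'x \<Rightarrow> 'v" where
  "A_op X \<Omega> \<phi> \<mu> = (\<lambda>x\<in>X. vm_integral \<Omega> \<mu> (\<phi> x))"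

definition vv_RKBS ::
  "('v \<Rightarrow> real) \<Rightarrow> 'x set \<Rightarrow> 'a::topological_space set \<Rightarrow> ('x \<Rightarrow> 'a \<Rightarrow> real) \<Rightarrow>
   ('x \<Rightarrow> 'v::euclidean_space) set" where
  "vv_RKBS nrm X \<Omega> \<phi> = A_op X \<Omega> \<phi> ` vector_measures nrm \<Omega>"

definition vv_RKBS_norm ::
  "('v \<Rightarrow> real) \<Rightarrow> 'x set \<Rightarrow> 'a::topological_space set \<Rightarrow> ('x \<Rightarrow> 'a \<Rightarrow> real) \<Rightarrow>
   ('x \<Rightarrow> 'v::euclidean_space) \<Rightarrow> real" where
  "vv_RKBS_norm nrm X \<Omega> \<phi> f =
     (INF \<mu> \<in> {\<mu> \<in> vector_measures nrm \<Omega>. f = A_op X \<Omega> \<phi> \<mu>}.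
        enn2real (total_variation nrm \<Omega> \<mu> \<Omega>))"

definition learning_objective ::
  "('v \<Rightarrow> real) \<Rightarrow> 'x set \<Rightarrow> 'a::topological_space set \<Rightarrow> ('x \<Rightarrow> 'a \<Rightarrow> real) \<Rightarrow>
   ('v \<Rightarrow> 'v \<Rightarrow> real) \<Rightarrow> real \<Rightarrow> ('n::finite \<Rightarrow> 'x) \<Rightarrow> ('n \<Rightarrow> 'v) \<Rightarrow>
   ('x \<Rightarrow> 'v::euclidean_space) \<Rightarrow> real" where
  "learning_objective nrm X \<Omega> \<phi> L lam xs ys f =
     1 / real CARD('n) * (\<Sum>n\<in>UNIV. L (f (xs n)) (ys n)) + lam * vv_RKBS_norm nrm X \<Omega> \<phi> f"

end

theory Submission
  imports Defs
begin

text \<open>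
  The data only see a measure \<open>\<mu>\<close> through \<open>T \<mu> = (\<integral>\<phi>(x\<^sub>n, w) d\<mu>(w))\<^sub>n\<close>, a vector in a space of
  dimension \<open>N d\<close>. Let \<open>C\<close> be the convex hull of \<open>0\<close> and of the atoms \<open>(\<phi>(x\<^sub>n, w) u)\<^sub>n\<close> with
  \<open>w \<in> \<Omega>\<close>, \<open>\<parallel>u\<parallel> \<le> 1\<close>. It is compact because \<open>\<phi>(x\<^sub>n, \<cdot>)\<close> vanishes at infinity, and approximating
  integrals by finite sums gives \<open>T \<mu> \<in> |\<mu>|(\<Omega>) C\<close>. Conversely, a conic version of Caratheodory's
  theorem writes every point of \<open>t C\<close> as \<open>T \<mu>'\<close> for a measure \<open>\<mu>'\<close> with at most \<open>N d\<close> atoms and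
  total variation at most \<open>t\<close>. The learning problem thus becomes the minimization of \<open>F(t k) + \<lambda> t\<close>
  over \<open>t \<ge> 0\<close>, \<open>k \<in> C\<close>, where \<open>F\<close> is the averaged loss. Coercivity of \<open>F\<close> bounds \<open>t k\<close>, and since
  \<open>0\<close> is a relative interior point of the symmetric set \<open>C\<close>, \<open>t\<close> may be bounded too, so that a
  minimum exists even for \<open>\<lambda> = 0\<close>.
\<close>

subsection \<open>Norms and convex sets in Euclidean space\<close>

lemma vector_normD:
  assumes "vector_norm nrm"
  shows "0 \<le> nrm v" "nrm v = 0 \<longleftrightarrow> v = 0" "nrm (c *\<^sub>R v) = \<bar>c\<bar> * nrm v"
    "nrm (u + v) \<le> nrm u + nrm v"
  using assms unfolding vector_norm_def by blast+

text \<open>Homogeneity and subadditivity make a norm convex, and a finite convex function on a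
  Euclidean space is continuous.\<close>

lemma continuous_on_vector_norm:
  fixes nrm :: "'v::euclidean_space \<Rightarrow> real"
  assumes "vector_norm nrm"
  shows "continuous_on UNIV nrm"
proof (rule convex_on_continuous)
  show "convex_on UNIV nrm"
  proof (rule convex_onI)
    fix t :: real and x y :: 'v
    assume "0 < t" "t < 1"
    then show "nrm ((1 - t) *\<^sub>R x + t *\<^sub>R y) \<le> (1 - t) * nrm x + t * nrm y"
      using vector_normD(4)[OF assms, of "(1 - t) *\<^sub>R x" "t *\<^sub>R y"]
      by (simp add: vector_normD(3)[OF assms])
  qed simp
qed simp

text \<open>By compactness \<open>nrm\<close> attains a positive minimum on the Euclidean unit
  sphere; its reciprocal serves as \<open>c\<close>, and homogeneity carries the bound to all
  vectors.\<close>

lemma norm_le_vector_norm: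
  fixes nrm :: "'v::euclidean_space \<Rightarrow> real"
  assumes "vector_norm nrm"
  obtains c where "0 < c" "\<And>v. norm v \<le> c * nrm v"
proof -
  have "\<exists>u\<in>sphere (0::'v) 1. \<forall>v\<in>sphere 0 1. nrm u \<le> nrm v"
    by (intro continuous_attains_inf continuous_on_subset[OF continuous_on_vector_norm[OF assms]]) auto
  then obtain u where u: "norm u = 1" "\<And>v. norm v = 1 \<Longrightarrow> nrm u \<le> nrm v"
    by auto
  have "u \<noteq> 0" using u(1) by auto
  then have pos: "0 < nrm u"
    using vector_normD(1,2)[OF assms, of u] by linarith
  show thesis
  proof
    show "0 < 1 / nrm u" using pos by simp
    fix v
    show "norm v \<le> 1 / nrm u * nrm v"
    proof (cases "v = 0")
      case False
      then have "nrm u \<le> nrm ((1 / norm v) *\<^sub>R v)" by (intro u(2)) simp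
      then show ?thesis using False pos by (simp add: vector_normD(3)[OF assms] field_simps)
    qed (use pos vector_normD(1)[OF assms] in simp)
  qed
qed

lemma compact_vector_norm_ball:
  fixes nrm :: "'v::euclidean_space \<Rightarrow> real"
  assumes "vector_norm nrm"
  shows "compact {v. nrm v \<le> 1}"
proof -
  obtain c where c: "0 < c" "\<And>v. norm v \<le> c * nrm v"
    using norm_le_vector_norm[OF assms] by blast
  have "norm v \<le> c" if "nrm v \<le> 1" for v
  proof -
    have "c * nrm v \<le> c * 1"
      using that c(1) by (intro mult_left_mono) auto
    then show ?thesis using c(2)[of v] by simp
  qed
  then have "bounded {v. nrm v \<le> 1}" by (auto intro: boundedI)
  moreover have "closed {v. nrm v \<le> 1}"
    by (intro closed_Collect_le continuous_on_vector_norm[OF assms] continuous_on_const)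
  ultimately show ?thesis by (simp add: compact_eq_bounded_closed)
qed

section \<open>Symmetric convex sets and penalized minimization\<close>

text \<open>For a nonzero relative interior point \<open>a\<close>, the open segment from
  \<open>a\<close> to \<open>- a\<close> stays in the relative interior, and its midpoint is
  0.\<close>

lemma zero_mem_rel_interior_symmetric:
  fixes C :: "'a::euclidean_space set"
  assumes "convex C" "C \<noteq> {}" "\<And>x. x \<in> C \<Longrightarrow> - x \<in> C"
  shows "0 \<in> rel_interior C"
proof -
  obtain a where a: "a \<in> rel_interior C"
    using assms rel_interior_eq_empty by blast
  show ?thesis
  proof (cases "a = 0")
    case False
    have "- a \<in> closure C"
      using a assms(3) rel_interior_subset closure_subset by blast
    then have "open_segment a (- a) \<subseteq> rel_interior C"
      by (rule rel_interior_closure_convex_segment[OF assms(1) a])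
    moreover have "a \<noteq> - a"
    proof
      assume "a = - a"
      then have "a + a = 0" by (metis add.right_inverse)
      then show False using False by (simp add: scaleR_2[symmetric])
    qed
    then have "0 \<in> open_segment a (- a)"
      by (auto simp: in_segment intro!: exI[of _ "1/2"])
    ultimately show ?thesis by blast
  qed (use a in simp)
qed

text \<open>As 0 is a relative interior point, \<open>C\<close> contains a small ball of its span; a
  single dilation takes this ball past radius \<open>R\<close>.\<close>

lemma symmetric_convex_absorbs_bounded_span:
  fixes C :: "'a::euclidean_space set"
  assumes "convex C" "C \<noteq> {}" "\<And>x. x \<in> C \<Longrightarrow> - x \<in> C"
  obtains T where "0 < T" "\<And>z. z \<in> span C \<Longrightarrow> norm z \<le> R \<Longrightarrow> \<exists>k\<in>C. z = T *\<^sub>R k"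
proof -
  obtain e where e: "0 < e" "ball 0 e \<inter> affine hull C \<subseteq> C" "0 \<in> C"
    using zero_mem_rel_interior_symmetric[OF assms] by (auto simp: mem_rel_interior_ball)
  have span: "affine hull C = span C"
    using e(3) by (intro affine_hull_span_0 hull_inc)
  \<comment> \<open>The absolute value and the summand 1 make \<open>T\<close> positive and
    \<open>T * e\<close> greater than \<open>R\<close>, whatever the sign of
    \<open>R\<close>.\<close>
  define T where "T = (\<bar>R\<bar> + 1) / e"
  have T: "0 < T" "\<bar>R\<bar> + 1 = T * e" using e(1) by (auto simp: T_def)
  show thesis
  proof
    fix z assume z: "z \<in> span C" "norm z \<le> R"
    have "norm z < e * T" using z(2) T by (simp add: mult.commute)
    then have "norm ((1 / T) *\<^sub>R z) < e" using T(1) by (simp add: field_simps)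
    then have "(1 / T) *\<^sub>R z \<in> C" using z(1) e(2) by (auto simp: span span_mul)
    then show "\<exists>k\<in>C. z = T *\<^sub>R k" using T(1) by (intro bexI[of _ "(1 / T) *\<^sub>R z"]) auto
  qed (rule T(1))
qed

text \<open>On \<open>t \<le> T\<close> the domain is compact, so a minimum exists there. A larger
  \<open>t\<close> cannot improve it: if \<open>t *\<^sub>R k\<close> has norm at most
  \<open>R\<close>, the same point is reached with \<open>T\<close> at no higher penalty, and
  otherwise the value at 0 is already smaller.\<close>

lemma penalized_minimum_exists:
  fixes C :: "'a::euclidean_space set" and F :: "'a \<Rightarrow> real"
  assumes C: "convex C" "compact C" "C \<noteq> {}" "\<And>x. x \<in> C \<Longrightarrow> - x \<in> C"
    and F: "continuous_on UNIV F" "\<And>z. R < norm z \<Longrightarrow> F 0 < F z"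
    and lam: "0 \<le> lam"
  obtains t\<^sub>0 k\<^sub>0 where "0 \<le> t\<^sub>0" "k\<^sub>0 \<in> C"
    "\<And>t k. 0 \<le> t \<Longrightarrow> k \<in> C \<Longrightarrow> F (t\<^sub>0 *\<^sub>R k\<^sub>0) + lam * t\<^sub>0 \<le> F (t *\<^sub>R k) + lam * t"
proof -
  obtain T where T: "0 < T" "\<And>z. z \<in> span C \<Longrightarrow> norm z \<le> R \<Longrightarrow> \<exists>k\<in>C. z = T *\<^sub>R k"
    using symmetric_convex_absorbs_bounded_span[OF C(1,3,4)] by blast
  define G where "G = (\<lambda>(t, k). F (t *\<^sub>R k) + lam * t)"
  have "continuous_on UNIV G"
    unfolding G_def split_def
    by (intro continuous_intros continuous_on_compose2[OF F(1)]) auto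
  then have "\<exists>p\<in>{0..T} \<times> C. \<forall>q\<in>{0..T} \<times> C. G p \<le> G q"
    using C(2,3) T(1)
    by (intro continuous_attains_inf compact_Times) (auto intro: continuous_on_subset)
  then obtain t0 k0 where m: "t0 \<in> {0..T}" "k0 \<in> C"
    "\<And>t k. t \<in> {0..T} \<Longrightarrow> k \<in> C \<Longrightarrow> F (t0 *\<^sub>R k0) + lam * t0 \<le> F (t *\<^sub>R k) + lam * t"
    unfolding G_def by (auto simp: Ball_def)
  show thesis
  proof (rule that[of t0 k0])
    fix t :: real and k assume t: "0 \<le> t" and k: "k \<in> C"
    show "F (t0 *\<^sub>R k0) + lam * t0 \<le> F (t *\<^sub>R k) + lam * t"
    proof (cases "norm (t *\<^sub>R k) \<le> R")
      case True
      show ?thesis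
      proof (cases "t \<le> T")
        case True
        then show ?thesis using m(3)[of t k] t k by simp
      next
        case False
        have "t *\<^sub>R k \<in> span C" using k by (simp add: span_mul span_base)
        then obtain k' where "k' \<in> C" "t *\<^sub>R k = T *\<^sub>R k'" using T(2) True by blast
        moreover have "lam * T \<le> lam * t" using False lam by (intro mult_left_mono) auto
        ultimately show ?thesis using m(3)[of T k'] T(1) by simp
      qed
    next
      case False
      then have "F 0 < F (t *\<^sub>R k)" using F(2)[of "t *\<^sub>R k"] by simp
      moreover have "F (t0 *\<^sub>R k0) + lam * t0 \<le> F 0" using m(3)[of 0 k] T(1) k by simp
      moreover have "0 \<le> lam * t" using lam t by simp
      ultimately show ?thesis by linarith
    qed
  qed (use m in auto)
qed

section \<open>Conic combinations\<close>

text \<open>Caratheodory reduction for cones: move the coefficients along a linear dependence until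
  one of them vanishes, then induct. The result is linearly, not just affinely, independent, which
  saves one vector against the convex version; in exchange the total weight may drop.\<close>

lemma conic_combination_independent:
  fixes c :: "'a::real_vector \<Rightarrow> real"
  assumes "finite S" "\<And>v. v \<in> S \<Longrightarrow> 0 \<le> c v"
  obtains B c' where "B \<subseteq> S" "independent B" "\<And>v. v \<in> B \<Longrightarrow> 0 \<le> c' v"
    "(\<Sum>v\<in>B. c' v *\<^sub>R v) = (\<Sum>v\<in>S. c v *\<^sub>R v)" "sum c' B \<le> sum c S"
  using assms
proof (induction "card S" arbitrary: S c thesis rule: less_induct)
  case less
  show ?case
  proof (cases "independent S")
    case True
    then show ?thesis using less.prems by blast
  next
    case False
    then obtain a where a: "\<exists>v\<in>S. a v \<noteq> 0" "(\<Sum>v\<in>S. a v *\<^sub>R v) = 0"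
      using dependent_finite[OF less.prems(2)] by blast
    \<comment> \<open>Either the dependence or its negative qualifies. A negative entry is needed to
      make some coefficient reach zero, a nonpositive sum to keep the total weight from
      growing.\<close>
    have "\<exists>a. (\<exists>v\<in>S. a v < 0) \<and> (\<Sum>v\<in>S. a v *\<^sub>R v) = 0 \<and> sum a S \<le> 0"
    proof (cases "sum a S < 0 \<or> (sum a S = 0 \<and> (\<exists>v\<in>S. a v < 0))")
      case True
      then have "\<exists>v\<in>S. a v < 0" using sum_nonneg[of S a] by force
      then show ?thesis using a(2) True by (intro exI[of _ a]) auto
    next
      case False
      have "\<exists>v\<in>S. 0 < a v"
      proof (rule ccontr)
        assume "\<not> ?thesis"
        then have np: "\<And>v. v \<in> S \<Longrightarrow> a v \<le> 0" by force
        then have "sum a S \<le> 0" by (intro sum_nonpos)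
        with False have "\<And>v. v \<in> S \<Longrightarrow> 0 \<le> a v" by force
        with np a(1) show False by force
      qed
      then show ?thesis using a(2) False
        by (intro exI[of _ "\<lambda>v. - a v"]) (auto simp: sum_negf)
    qed
    then obtain a where a: "\<exists>v\<in>S. a v < 0" "(\<Sum>v\<in>S. a v *\<^sub>R v) = 0" "sum a S \<le> 0"
      by blast
    define N where "N = {v\<in>S. a v < 0}"
    \<comment> \<open>The largest step along \<open>a\<close> that keeps all coefficients
      nonnegative; at a minimizer \<open>w\<close> the coefficient becomes 0.\<close>
    define s where "s = Min ((\<lambda>v. c v / - a v) ` N)"
    have N: "finite N" "N \<noteq> {}" "N \<subseteq> S" using a(1) less.prems(2) by (auto simp: N_def)
    have sle: "s \<le> c v / - a v" if "v \<in> N" for v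
      using that N(1) by (auto simp: s_def)
    have "s \<in> (\<lambda>v. c v / - a v) ` N" unfolding s_def using N by (intro Min_in) auto
    then obtain w where w: "w \<in> N" "s = c w / - a w" by auto
    have s0: "0 \<le> s" using w less.prems(3)[of w] by (simp add: N_def divide_nonneg_neg)
    define c' where "c' = (\<lambda>v. c v + s * a v)"
    have c'w: "c' w = 0" using w by (auto simp: c'_def N_def field_simps)
    have c'0: "0 \<le> c' v" if "v \<in> S" for v
    proof (cases "v \<in> N")
      case True
      then have "s * (- a v) \<le> c v"
        using sle[OF True] by (subst (asm) pos_le_divide_eq) (auto simp: N_def)
      then show ?thesis by (simp add: c'_def)
    next
      case False
      then show ?thesis using that less.prems(3)[of v] s0 by (auto simp: c'_def N_def)
    qed
    have wS: "w \<in> S" using w N by auto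
    have "(\<Sum>v\<in>S. c' v *\<^sub>R v) = (\<Sum>v\<in>S. c v *\<^sub>R v) + s *\<^sub>R (\<Sum>v\<in>S. a v *\<^sub>R v)"
      by (simp add: c'_def scaleR_left_distrib sum.distrib scaleR_sum_right)
    then have "(\<Sum>v\<in>S - {w}. c' v *\<^sub>R v) = (\<Sum>v\<in>S. c v *\<^sub>R v)"
      using a(2) c'w wS less.prems(2) by (simp add: sum_diff1)
    moreover have "sum c' (S - {w}) \<le> sum c S"
    proof -
      have "sum c' (S - {w}) = sum c' S" using c'w wS less.prems(2) by (simp add: sum_diff1)
      also have "\<dots> = sum c S + s * sum a S"
        by (simp add: c'_def sum.distrib sum_distrib_left)
      also have "\<dots> \<le> sum c S" using s0 a(3) by (simp add: mult_nonneg_nonpos)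
      finally show ?thesis .
    qed
    moreover have "card (S - {w}) < card S"
      using wS less.prems(2) by (intro psubset_card_mono) auto
    ultimately show ?thesis
      using less.hyps[of "S - {w}" c'] c'0 less.prems(1,2)
      by (smt (verit, best) DiffD1 Diff_subset finite_Diff subset_trans)
  qed
qed

text \<open>Dividing by the total weight \<open>?s\<close> gives a convex combination, and the
  factor \<open>?s / t \<le> 1\<close> shrinks it towards 0 within \<open>C\<close>. If the total
  weight is 0, all terms vanish.\<close>

lemma sum_scaleR_mem_scaled_convex:
  fixes k :: "'i \<Rightarrow> 'a::real_vector"
  assumes C: "convex C" "0 \<in> C" and I: "finite I" "\<And>i. i \<in> I \<Longrightarrow> 0 \<le> c i" "\<And>i. i \<in> I \<Longrightarrow> k i \<in> C"
    and t: "sum c I \<le> t"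
  shows "(\<Sum>i\<in>I. c i *\<^sub>R k i) \<in> (*\<^sub>R) t ` C"
proof (cases "sum c I = 0")
  case True
  then have "\<And>i. i \<in> I \<Longrightarrow> c i = 0" using I sum_nonneg_eq_0_iff[of I c] by auto
  then have "(\<Sum>i\<in>I. c i *\<^sub>R k i) = t *\<^sub>R 0" by simp
  then show ?thesis using C(2) by (rule image_eqI)
next
  case False
  let ?s = "sum c I"
  have s: "0 < ?s" using False sum_nonneg[of I c] I(2) by fastforce
  have "(\<Sum>i\<in>I. (c i / ?s) *\<^sub>R k i) \<in> C"
    using s I by (intro convex_sum C) (auto simp: sum_divide_distrib[symmetric])
  then have "(?s / t) *\<^sub>R (\<Sum>i\<in>I. (c i / ?s) *\<^sub>R k i) + (1 - ?s / t) *\<^sub>R 0 \<in> C"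
    using s t C by (intro convexD) auto
  moreover have "(\<Sum>i\<in>I. c i *\<^sub>R k i) = t *\<^sub>R ((?s / t) *\<^sub>R (\<Sum>i\<in>I. (c i / ?s) *\<^sub>R k i))"
    using s t by (simp add: scaleR_sum_right)
  ultimately show ?thesis by (intro image_eqI) auto
qed

subsection \<open>Integration against vector measures\<close>

text \<open>The constant sequence of empty sets is disjoint, and a series with constant terms
  converges only if they are zero.\<close>

lemma vm_empty:
  assumes "countably_additive_vm \<Omega> \<mu>"
  shows "\<mu> {} = 0"
proof -
  have "(\<lambda>i::nat. \<mu> {}) sums \<mu> (\<Union>i::nat. {})"
    using assms[unfolded countably_additive_vm_def, rule_format, of "\<lambda>i. {}"]
    by (simp add: disjoint_family_on_def)
  then have "summable (\<lambda>i::nat. \<mu> {})" by (rule sums_summable)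
  then show ?thesis by (simp add: summable_const_iff)
qed

lemma vm_Un:
  assumes "countably_additive_vm \<Omega> \<mu>"
    and "A \<in> sets (borel_of_subspace \<Omega>)" "B \<in> sets (borel_of_subspace \<Omega>)" "A \<inter> B = {}"
  shows "\<mu> (A \<union> B) = \<mu> A + \<mu> B"
proof -
  have "range (binaryset A B) \<subseteq> sets (borel_of_subspace \<Omega>)"
    using assms(2,3) by (simp add: range_binaryset_eq)
  moreover have "disjoint_family (binaryset A B)"
    using assms(4) by (auto simp: disjoint_family_on_def binaryset_def)
  ultimately have "(\<lambda>i. \<mu> (binaryset A B i)) sums \<mu> (\<Union>i. binaryset A B i)"
    using assms(1) unfolding countably_additive_vm_def by blast
  then show ?thesis
    using binaryset_sums[of \<mu> A B] vm_empty[OF assms(1)] sums_unique2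
    by (fastforce simp: UN_binaryset_eq)
qed

lemma vm_finite_UN:
  assumes "countably_additive_vm \<Omega> \<mu>"
    and "finite I" "\<And>i. i \<in> I \<Longrightarrow> A i \<in> sets (borel_of_subspace \<Omega>)" "disjoint_family_on A I"
  shows "\<mu> (\<Union>i\<in>I. A i) = (\<Sum>i\<in>I. \<mu> (A i))"
  using assms(2-4)
proof (induction I rule: finite_induct)
  case (insert j I)
  have "\<mu> (A j \<union> (\<Union>i\<in>I. A i)) = \<mu> (A j) + \<mu> (\<Union>i\<in>I. A i)"
  proof (rule vm_Un[OF assms(1)])
    show "A j \<in> sets (borel_of_subspace \<Omega>)" using insert.prems(1) by simp
    show "(\<Union>i\<in>I. A i) \<in> sets (borel_of_subspace \<Omega>)"
      using insert.prems(1) insert.hyps(1) by (intro sets.finite_UN) auto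
    show "A j \<inter> (\<Union>i\<in>I. A i) = {}"
      using insert.prems(2) insert.hyps(2) by (auto simp: disjoint_family_on_def)
  qed
  moreover have "disjoint_family_on A I"
    using insert.prems(2) by (auto simp: disjoint_family_on_def)
  ultimately show ?case using insert by simp
qed (simp add: vm_empty[OF assms(1)])

text \<open>Finite additivity splits each level set of the composition into fibers of
  \<open>h\<close>. Since \<open>h\<close> may have values of any type, several simple functions can
  be integrated over one common partition.\<close>

lemma simple_vm_integral_comp:
  assumes "countably_additive_vm \<Omega> \<mu>" and h: "simple_function (borel_of_subspace \<Omega>) h"
  shows "simple_vm_integral \<Omega> \<mu> (\<lambda>w. g (h w)) = (\<Sum>b\<in>h ` \<Omega>. g b *\<^sub>R \<mu> (h -` {b} \<inter> \<Omega>))"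
proof -
  have fin: "finite (h ` \<Omega>)" and sets: "\<And>b. b \<in> h ` \<Omega> \<Longrightarrow> h -` {b} \<inter> \<Omega> \<in> sets (borel_of_subspace \<Omega>)"
    using h by (auto simp: simple_function_def space_restrict_space)
  have "simple_vm_integral \<Omega> \<mu> (\<lambda>w. g (h w)) =
      (\<Sum>c\<in>g ` h ` \<Omega>. c *\<^sub>R \<mu> ((\<lambda>w. g (h w)) -` {c} \<inter> \<Omega>))"
    by (simp add: simple_vm_integral_def image_image)
  also have "\<dots> = (\<Sum>c\<in>g ` h ` \<Omega>. \<Sum>b\<in>{b\<in>h ` \<Omega>. g b = c}. g b *\<^sub>R \<mu> (h -` {b} \<inter> \<Omega>))"
  proof (rule sum.cong[OF refl])
    fix c
    have "(\<lambda>w. g (h w)) -` {c} \<inter> \<Omega> = (\<Union>b\<in>{b\<in>h ` \<Omega>. g b = c}. h -` {b} \<inter> \<Omega>)" by auto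
    moreover have "\<mu> \<dots> = (\<Sum>b\<in>{b\<in>h ` \<Omega>. g b = c}. \<mu> (h -` {b} \<inter> \<Omega>))"
      using fin sets by (intro vm_finite_UN[OF assms(1)]) (auto simp: disjoint_family_on_def)
    ultimately show "c *\<^sub>R \<mu> ((\<lambda>w. g (h w)) -` {c} \<inter> \<Omega>) =
        (\<Sum>b\<in>{b\<in>h ` \<Omega>. g b = c}. g b *\<^sub>R \<mu> (h -` {b} \<inter> \<Omega>))"
      by (auto simp: scaleR_sum_right)
  qed
  also have "\<dots> = (\<Sum>b\<in>h ` \<Omega>. g b *\<^sub>R \<mu> (h -` {b} \<inter> \<Omega>))"
    using fin by (intro sum.image_gen[symmetric])
  finally show ?thesis .
qed

text \<open>The fibers of \<open>h\<close> form one of the finite measurable partitions in the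
  supremum.\<close>

lemma sum_fibers_le_total_variation:
  assumes nrm: "vector_norm nrm" and tv: "total_variation nrm \<Omega> \<mu> \<Omega> < \<infinity>"
    and h: "simple_function (borel_of_subspace \<Omega>) h"
  shows "(\<Sum>b\<in>h ` \<Omega>. nrm (\<mu> (h -` {b} \<inter> \<Omega>))) \<le> enn2real (total_variation nrm \<Omega> \<mu> \<Omega>)"
proof -
  have fin: "finite (h ` \<Omega>)" and sets: "\<And>b. b \<in> h ` \<Omega> \<Longrightarrow> h -` {b} \<inter> \<Omega> \<in> sets (borel_of_subspace \<Omega>)"
    using h by (auto simp: simple_function_def space_restrict_space)
  let ?P = "(\<lambda>b. h -` {b} \<inter> \<Omega>) ` (h ` \<Omega>)"
  have inj: "inj_on (\<lambda>b. h -` {b} \<inter> \<Omega>) (h ` \<Omega>)" by (auto simp: inj_on_def)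
  have "ennreal (\<Sum>b\<in>h ` \<Omega>. nrm (\<mu> (h -` {b} \<inter> \<Omega>))) = (\<Sum>A\<in>?P. ennreal (nrm (\<mu> A)))"
    using vector_normD(1)[OF nrm] by (simp add: sum.reindex[OF inj])
  also have "\<dots> \<le> total_variation nrm \<Omega> \<mu> \<Omega>"
    unfolding total_variation_def
    using fin sets by (intro SUP_upper) (auto simp: partition_on_def disjoint_def)
  finally have "enn2real (ennreal (\<Sum>b\<in>h ` \<Omega>. nrm (\<mu> (h -` {b} \<inter> \<Omega>)))) \<le>
      enn2real (total_variation nrm \<Omega> \<mu> \<Omega>)"
    using tv by (intro enn2real_mono) auto
  then show ?thesis using vector_normD(1)[OF nrm] by (simp add: sum_nonneg)
qed

section \<open>Integrals as limits of simple integrals\<close>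

text \<open>Both functions are constant on the fibers of the pair \<open>(s, s')\<close>, so the
  difference is a sum over these fibers with coefficients at most \<open>e\<close>; the constant
  \<open>c\<close> passes from the Euclidean norm to \<open>nrm\<close>.\<close>

lemma simple_vm_integral_diff_le:
  assumes nrm: "vector_norm nrm" and c: "0 \<le> c" "\<And>v. norm v \<le> c * nrm v"
    and \<mu>: "\<mu> \<in> vector_measures nrm \<Omega>"
    and s: "simple_function (borel_of_subspace \<Omega>) s" "simple_function (borel_of_subspace \<Omega>) s'"
    and e: "0 \<le> e" "\<And>w. w \<in> \<Omega> \<Longrightarrow> \<bar>s w - s' w\<bar> \<le> e"
  shows "norm (simple_vm_integral \<Omega> \<mu> s - simple_vm_integral \<Omega> \<mu> s') \<le>
    e * (c * enn2real (total_variation nrm \<Omega> \<mu> \<Omega>))"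
proof -
  have ca: "countably_additive_vm \<Omega> \<mu>" and tv: "total_variation nrm \<Omega> \<mu> \<Omega> < \<infinity>"
    using \<mu> by (auto simp: vector_measures_def)
  define h where "h = (\<lambda>w. (s w, s' w))"
  have h: "simple_function (borel_of_subspace \<Omega>) h"
    unfolding h_def using s by (rule simple_function_Pair)
  have "simple_vm_integral \<Omega> \<mu> s - simple_vm_integral \<Omega> \<mu> s' =
      (\<Sum>b\<in>h ` \<Omega>. (fst b - snd b) *\<^sub>R \<mu> (h -` {b} \<inter> \<Omega>))"
    using simple_vm_integral_comp[OF ca h, of fst] simple_vm_integral_comp[OF ca h, of snd]
    by (simp add: h_def scaleR_diff_left sum_subtractf)
  also have "norm \<dots> \<le> (\<Sum>b\<in>h ` \<Omega>. e * (c * nrm (\<mu> (h -` {b} \<inter> \<Omega>))))"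
  proof (rule sum_norm_le)
    fix b assume "b \<in> h ` \<Omega>"
    then have "\<bar>fst b - snd b\<bar> \<le> e" using e(2) by (auto simp: h_def)
    then show "norm ((fst b - snd b) *\<^sub>R \<mu> (h -` {b} \<inter> \<Omega>)) \<le> e * (c * nrm (\<mu> (h -` {b} \<inter> \<Omega>)))"
      using c(2) e(1) by (simp add: mult_mono)
  qed
  also have "\<dots> = e * (c * (\<Sum>b\<in>h ` \<Omega>. nrm (\<mu> (h -` {b} \<inter> \<Omega>))))"
    by (simp add: sum_distrib_left)
  also have "\<dots> \<le> e * (c * enn2real (total_variation nrm \<Omega> \<mu> \<Omega>))"
    using sum_fibers_le_total_variation[OF nrm tv h] c e by (intro mult_left_mono) auto
  finally show ?thesis .
qed

text \<open>Stated for two sequences so that it serves twice: with equal ones it gives the Cauchy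
  property, with different ones independence of the approximation.\<close>

lemma simple_vm_integrals_eventually_close:
  assumes nrm: "vector_norm nrm" and \<mu>: "\<mu> \<in> vector_measures nrm \<Omega>"
    and s: "\<And>k. simple_function (borel_of_subspace \<Omega>) (s k)" "uniform_limit \<Omega> s f sequentially"
    and s': "\<And>k. simple_function (borel_of_subspace \<Omega>) (s' k)" "uniform_limit \<Omega> s' f sequentially"
    and e: "0 < e"
  shows "\<exists>M. \<forall>k\<ge>M. \<forall>l\<ge>M. dist (simple_vm_integral \<Omega> \<mu> (s k)) (simple_vm_integral \<Omega> \<mu> (s' l)) < e"
proof -
  obtain c where c: "0 < c" "\<And>v. norm v \<le> c * nrm v"
    using norm_le_vector_norm[OF nrm] by blast
  let ?V = "c * enn2real (total_variation nrm \<Omega> \<mu> \<Omega>)"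
  \<comment> \<open>The summand 1 covers a measure of variation zero and makes
    \<open>d * ?V < e\<close> strict.\<close>
  define d where "d = e / (?V + 1)"
  have V: "0 \<le> ?V" using c by simp
  have d: "0 < d" "d * ?V < e" using e V by (auto simp: d_def field_simps add_nonneg_pos)
  have "\<forall>\<^sub>F k in sequentially. \<forall>w\<in>\<Omega>. dist (s k w) (f w) < d / 2"
    using uniform_limitD[OF s(2), of "d / 2"] d(1) by simp
  moreover have "\<forall>\<^sub>F k in sequentially. \<forall>w\<in>\<Omega>. dist (s' k w) (f w) < d / 2"
    using uniform_limitD[OF s'(2), of "d / 2"] d(1) by simp
  ultimately obtain M M' where M: "\<And>k w. k \<ge> M \<Longrightarrow> w \<in> \<Omega> \<Longrightarrow> dist (s k w) (f w) < d / 2"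
    "\<And>k w. k \<ge> M' \<Longrightarrow> w \<in> \<Omega> \<Longrightarrow> dist (s' k w) (f w) < d / 2"
    unfolding eventually_sequentially by blast
  have "dist (simple_vm_integral \<Omega> \<mu> (s k)) (simple_vm_integral \<Omega> \<mu> (s' l)) < e"
    if "k \<ge> max M M'" "l \<ge> max M M'" for k l
  proof -
    have "\<bar>s k w - s' l w\<bar> \<le> d" if "w \<in> \<Omega>" for w
    proof -
      have "\<bar>s k w - f w\<bar> < d / 2" "\<bar>s' l w - f w\<bar> < d / 2"
        using M(1)[of k w] M(2)[of l w] that \<open>k \<ge> max M M'\<close> \<open>l \<ge> max M M'\<close>
        by (simp_all add: dist_real_def)
      then show ?thesis by (simp add: abs_real_def split: if_splits)
    qed
    then have "norm (simple_vm_integral \<Omega> \<mu> (s k) - simple_vm_integral \<Omega> \<mu> (s' l)) \<le> d * ?V"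
      using c d by (intro simple_vm_integral_diff_le[OF nrm _ c(2) \<mu> s(1) s'(1)]) auto
    then show ?thesis using d(2) by (simp add: dist_norm)
  qed
  then show ?thesis by blast
qed

text \<open>Two approximating sequences have simple integrals at vanishing distance, hence equal
  limits. This justifies the definite description in \<open>vm_integral\<close>.\<close>

lemma has_vm_integral_unique:
  assumes "vector_norm nrm" "\<mu> \<in> vector_measures nrm \<Omega>"
    and "has_vm_integral \<Omega> \<mu> f I" "has_vm_integral \<Omega> \<mu> f J"
  shows "I = J"
proof -
  obtain s s' where
    s: "\<And>k. simple_function (borel_of_subspace \<Omega>) (s k)" "uniform_limit \<Omega> s f sequentially"
      "(\<lambda>k. simple_vm_integral \<Omega> \<mu> (s k)) \<longlonglongrightarrow> I"
    and s': "\<And>k. simple_function (borel_of_subspace \<Omega>) (s' k)" "uniform_limit \<Omega> s' f sequentially"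
      "(\<lambda>k. simple_vm_integral \<Omega> \<mu> (s' k)) \<longlonglongrightarrow> J"
    using assms(3,4) unfolding has_vm_integral_def by blast
  have "(\<lambda>k. dist (simple_vm_integral \<Omega> \<mu> (s k)) (simple_vm_integral \<Omega> \<mu> (s' k))) \<longlonglongrightarrow> 0"
    using simple_vm_integrals_eventually_close[OF assms(1,2) s(1,2) s'(1,2)]
    by (simp add: LIMSEQ_iff) blast
  moreover have "(\<lambda>k. dist (simple_vm_integral \<Omega> \<mu> (s k)) (simple_vm_integral \<Omega> \<mu> (s' k))) \<longlonglongrightarrow> dist I J"
    using s(3) s'(3) by (rule tendsto_dist)
  ultimately show ?thesis using LIMSEQ_unique by fastforce
qed

lemma vm_integral_eqI:
  assumes "vector_norm nrm" "\<mu> \<in> vector_measures nrm \<Omega>" "has_vm_integral \<Omega> \<mu> f I"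
  shows "vm_integral \<Omega> \<mu> f = I"
  unfolding vm_integral_def
proof (rule the_equality[where P = "has_vm_integral \<Omega> \<mu> f", OF assms(3)])
  show "J = I" if "has_vm_integral \<Omega> \<mu> f J" for J
    using has_vm_integral_unique[OF assms(1,2) that assms(3)] .
qed

lemma tendsto_vm_integral:
  assumes nrm: "vector_norm nrm" and \<mu>: "\<mu> \<in> vector_measures nrm \<Omega>"
    and s: "\<And>k. simple_function (borel_of_subspace \<Omega>) (s k)" "uniform_limit \<Omega> s f sequentially"
  shows "(\<lambda>k. simple_vm_integral \<Omega> \<mu> (s k)) \<longlonglongrightarrow> vm_integral \<Omega> \<mu> f"
proof -
  have "Cauchy (\<lambda>k. simple_vm_integral \<Omega> \<mu> (s k))"
  proof (rule metric_CauchyI)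
    fix e :: real assume "0 < e"
    then show "\<exists>M. \<forall>k\<ge>M. \<forall>l\<ge>M.
        dist (simple_vm_integral \<Omega> \<mu> (s k)) (simple_vm_integral \<Omega> \<mu> (s l)) < e"
      by (rule simple_vm_integrals_eventually_close[OF nrm \<mu> s s])
  qed
  then obtain I where I: "(\<lambda>k. simple_vm_integral \<Omega> \<mu> (s k)) \<longlonglongrightarrow> I"
    by (auto simp: Cauchy_convergent_iff convergent_def)
  then have "has_vm_integral \<Omega> \<mu> f I" unfolding has_vm_integral_def using s by blast
  from vm_integral_eqI[OF nrm \<mu> this] show ?thesis using I by simp
qed

section \<open>Uniform approximation by sampling\<close>

text \<open>Values are rounded down to a grid of mesh \<open>e\<close>: \<open>h w\<close> records
  the cells of all \<open>f n w\<close> at once, and \<open>r\<close> picks a sample point in each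
  fiber. Evaluating at points of \<open>\<Omega>\<close> instead of at grid values makes the
  approximating integrals combinations of genuine atoms.\<close>

lemma uniform_simple_approximation:
  fixes f :: "'n::finite \<Rightarrow> 'a::topological_space \<Rightarrow> real"
  assumes meas: "\<And>n. f n \<in> borel_measurable (borel_of_subspace \<Omega>)"
    and bdd: "\<And>n w. w \<in> \<Omega> \<Longrightarrow> \<bar>f n w\<bar> \<le> M" and e: "0 < e"
  obtains h :: "'a \<Rightarrow> 'n \<Rightarrow> int" and r where "simple_function (borel_of_subspace \<Omega>) h"
    "\<And>b. b \<in> h ` \<Omega> \<Longrightarrow> r b \<in> \<Omega>" "\<And>n w. w \<in> \<Omega> \<Longrightarrow> \<bar>f n (r (h w)) - f n w\<bar> < e"
proof -
  define h where "h = (\<lambda>w n. \<lfloor>f n w / e\<rfloor>)"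
  define r where "r = (\<lambda>b. SOME w. w \<in> \<Omega> \<and> h w = b)"
  have r: "r (h w) \<in> \<Omega> \<and> h (r (h w)) = h w" if "w \<in> \<Omega>" for w
    unfolding r_def by (rule someI[of "\<lambda>v. v \<in> \<Omega> \<and> h v = h w" w]) (simp add: that)
  show thesis
  proof (rule that[of h r])
    \<comment> \<open>Boundedness confines the codes to a finite box, so \<open>h\<close> has
      finitely many values.\<close>
    have range: "h w n \<in> {\<lfloor>- M / e\<rfloor>..\<lfloor>M / e\<rfloor>}" if "w \<in> \<Omega>" for w n
    proof -
      have "- M \<le> f n w" "f n w \<le> M" using bdd[OF that, of n] by auto
      then have "- M / e \<le> f n w / e" "f n w / e \<le> M / e"
        using e by (simp_all only: divide_right_mono less_imp_le)
      then show ?thesis unfolding h_def atLeastAtMost_iff by (blast intro: floor_mono)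
    qed
    have sub: "h ` \<Omega> \<subseteq> (\<Pi>\<^sub>E n\<in>UNIV. {\<lfloor>- M / e\<rfloor>..\<lfloor>M / e\<rfloor>})"
      using range by (intro image_subsetI PiE_I) auto
    have "h -` {b} \<inter> \<Omega> \<in> sets (borel_of_subspace \<Omega>)" for b
    proof -
      have "h -` {b} \<inter> \<Omega> = (\<Inter>n. f n -` {w. of_int (b n) \<le> w / e \<and> w / e < of_int (b n) + 1}
          \<inter> space (borel_of_subspace \<Omega>))"
        by (auto simp: h_def space_restrict_space fun_eq_iff floor_eq_iff)
      also have "\<dots> \<in> sets (borel_of_subspace \<Omega>)"
        by (intro sets.finite_INT measurable_sets[OF meas]) auto
      finally show ?thesis .
    qed
    then show "simple_function (borel_of_subspace \<Omega>) h"
      using finite_subset[OF sub] by (simp add: simple_function_def space_restrict_space finite_PiE)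
    show "r b \<in> \<Omega>" if "b \<in> h ` \<Omega>" for b using r that by auto
    fix n w assume "w \<in> \<Omega>"
    then have "\<lfloor>f n (r (h w)) / e\<rfloor> = \<lfloor>f n w / e\<rfloor>" using r[of w] unfolding h_def by meson
    then have "\<bar>f n (r (h w)) / e - f n w / e\<bar> < 1" by linarith
    then have "\<bar>f n (r (h w)) - f n w\<bar> / e < 1" using e
      by (simp add: diff_divide_distrib[symmetric] abs_divide)
    then show "\<bar>f n (r (h w)) - f n w\<bar> < e" using e by simp
  qed
qed

lemma uniform_simple_sequence:
  fixes f :: "'n::finite \<Rightarrow> 'a::topological_space \<Rightarrow> real"
  assumes meas: "\<And>n. f n \<in> borel_measurable (borel_of_subspace \<Omega>)"
    and bdd: "\<And>n w. w \<in> \<Omega> \<Longrightarrow> \<bar>f n w\<bar> \<le> M"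
  obtains h :: "nat \<Rightarrow> 'a \<Rightarrow> 'n \<Rightarrow> int" and r where
    "\<And>k. simple_function (borel_of_subspace \<Omega>) (h k)"
    "\<And>k b. b \<in> h k ` \<Omega> \<Longrightarrow> r k b \<in> \<Omega>"
    "\<And>n. uniform_limit \<Omega> (\<lambda>k w. f n (r k (h k w))) (f n) sequentially"
proof -
  have "\<exists>h r. simple_function (borel_of_subspace \<Omega>) (h :: 'a \<Rightarrow> 'n \<Rightarrow> int) \<and> (\<forall>b\<in>h ` \<Omega>. r b \<in> \<Omega>) \<and>
      (\<forall>n. \<forall>w\<in>\<Omega>. \<bar>f n (r (h w)) - f n w\<bar> < inverse (real (Suc k)))" for k
  proof (rule uniform_simple_approximation[of f \<Omega> M "inverse (real (Suc k))"])
    fix h :: "'a \<Rightarrow> 'n \<Rightarrow> int" and r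
    assume "simple_function (borel_of_subspace \<Omega>) h" "\<And>b. b \<in> h ` \<Omega> \<Longrightarrow> r b \<in> \<Omega>"
      "\<And>n w. w \<in> \<Omega> \<Longrightarrow> \<bar>f n (r (h w)) - f n w\<bar> < inverse (real (Suc k))"
    then show ?thesis by blast
  qed (use meas bdd in auto)
  then obtain h r where hr: "\<And>k. simple_function (borel_of_subspace \<Omega>) (h k :: 'a \<Rightarrow> 'n \<Rightarrow> int)"
    "\<And>k. \<forall>b\<in>h k ` \<Omega>. r k b \<in> \<Omega>"
    "\<And>k. \<forall>n. \<forall>w\<in>\<Omega>. \<bar>f n (r k (h k w)) - f n w\<bar> < inverse (real (Suc k))"
    by metis
  show thesis
  proof (rule that[of h r])
    show "r k b \<in> \<Omega>" if "b \<in> h k ` \<Omega>" for k b using hr(2) that by blast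
    show "uniform_limit \<Omega> (\<lambda>k w. f n (r k (h k w))) (f n) sequentially" for n
    proof (rule uniform_limitI)
      fix e :: real assume "0 < e"
      then have "\<forall>\<^sub>F k in sequentially. inverse (real (Suc k)) < e"
        using LIMSEQ_inverse_real_of_nat by (rule order_tendstoD(2)[rotated])
      then show "\<forall>\<^sub>F k in sequentially. \<forall>w\<in>\<Omega>. dist (f n (r k (h k w))) (f n w) < e"
      proof eventually_elim
        case (elim k)
        then show ?case using hr(3)[of k] unfolding dist_real_def by (meson less_trans)
      qed
    qed
  qed (rule hr(1))
qed

subsection \<open>Atomic vector measures\<close>

text \<open>A sum of Dirac masses at \<open>w m\<close> with vector weights \<open>v m\<close>.
  Points may coincide and weights may be 0, so a fixed index type accommodates any smaller number of
  atoms.\<close>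

definition atomic_vm :: "('m::finite \<Rightarrow> 'a) \<Rightarrow> ('m \<Rightarrow> 'v::real_vector) \<Rightarrow> 'a set \<Rightarrow> 'v" where
  "atomic_vm w v E = (\<Sum>m\<in>UNIV. indicator E (w m) *\<^sub>R v m)"

lemma vector_norm_sum_le:
  assumes "vector_norm nrm"
  shows "nrm (\<Sum>i\<in>I. g i) \<le> (\<Sum>i\<in>I. nrm (g i))"
proof (induction I rule: infinite_finite_induct)
  case (insert i I)
  then show ?case using vector_normD(4)[OF assms, of "g i" "\<Sum>i\<in>I. g i"] by simp
qed (simp_all add: vector_normD(2)[OF assms, of 0, THEN iffD2])

text \<open>Every atom in \<open>E\<close> lies in exactly one cell of a partition; the triangle
  inequality in each cell and an exchange of sums give the bound. Atoms at the same point may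
  cancel, so equality can fail.\<close>

lemma total_variation_atomic_vm_le:
  fixes v :: "'m::finite \<Rightarrow> 'v::euclidean_space" and w :: "'m \<Rightarrow> 'a::topological_space"
  assumes nrm: "vector_norm nrm"
  shows "total_variation nrm \<Omega> (atomic_vm w v) E \<le>
    ennreal (\<Sum>m\<in>UNIV. indicator E (w m) * nrm (v m))"
  unfolding total_variation_def
proof (rule SUP_least, clarify)
  fix P :: "'a set set" assume fin: "finite P" and P: "partition_on E P"
  have ind: "(\<Sum>A\<in>P. indicator A x) = (indicator E x :: real)" for x
  proof -
    have disj: "disjoint_family_on (\<lambda>A. A) P" and E: "\<Union>P = E"
      using P by (auto simp: partition_on_def disjoint_family_on_def disjoint_def)
    have "(indicator (\<Union>A\<in>P. A) x :: real) = (\<Sum>A\<in>P. indicator A x)"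
      by (rule indicator_UN_disjoint[OF fin disj])
    then show ?thesis using E by simp
  qed
  have "(\<Sum>A\<in>P. nrm (atomic_vm w v A)) \<le> (\<Sum>A\<in>P. \<Sum>m\<in>UNIV. indicator A (w m) * nrm (v m))"
  proof (rule sum_mono)
    fix A
    show "nrm (atomic_vm w v A) \<le> (\<Sum>m\<in>UNIV. indicator A (w m) * nrm (v m))"
      unfolding atomic_vm_def
      by (rule order_trans[OF vector_norm_sum_le[OF nrm]]) (simp add: vector_normD(3)[OF nrm])
  qed
  also have "\<dots> = (\<Sum>m\<in>UNIV. indicator E (w m) * nrm (v m))"
    by (subst sum.swap) (simp add: sum_distrib_right[symmetric] ind)
  finally show "(\<Sum>A\<in>P. ennreal (nrm (atomic_vm w v A))) \<le>
      ennreal (\<Sum>m\<in>UNIV. indicator E (w m) * nrm (v m))"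
    using vector_normD(1)[OF nrm] by (simp add: ennreal_leI)
qed

lemma atomic_vm_in_vector_measures:
  fixes v :: "'m::finite \<Rightarrow> 'v::euclidean_space" and w :: "'m \<Rightarrow> 'a::t1_space"
  assumes nrm: "vector_norm nrm"
  shows "atomic_vm w v \<in> vector_measures nrm \<Omega>"
proof -
  have "countably_additive_vm \<Omega> (atomic_vm w v)"
    unfolding countably_additive_vm_def
  proof (intro allI impI)
    fix A :: "nat \<Rightarrow> 'a set" assume disj: "disjoint_family A"
    have "(\<lambda>i. indicator (A i) x :: real) sums indicator (\<Union>i. A i) x" for x
    proof (cases "x \<in> (\<Union>i. A i)")
      case True
      then obtain j where j: "x \<in> A j" by blast
      then have "(\<lambda>i. indicator (A i) x) = (\<lambda>i. if i = j then 1 else 0 :: real)"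
        using disj by (fastforce simp: fun_eq_iff disjoint_family_on_def indicator_def)
      then show ?thesis using True sums_single[of j "\<lambda>_. 1 :: real"] by simp
    next
      case False
      then have "(\<lambda>i. indicator (A i) x) = (\<lambda>i. 0 :: real)" by auto
      then show ?thesis using False by simp
    qed
    then show "(\<lambda>i. atomic_vm w v (A i)) sums atomic_vm w v (\<Union>i. A i)"
      unfolding atomic_vm_def by (intro sums_sum sums_scaleR_left)
  qed
  moreover have "regular_vm nrm \<Omega> (atomic_vm w v)"
    unfolding regular_vm_def
  proof (intro ballI allI impI)
    fix E :: "'a set" and e :: real
    assume E: "E \<in> sets (borel_of_subspace \<Omega>)" and e: "0 < e"
    \<comment> \<open>The inner set keeps the atoms in \<open>E\<close>, the outer set deletes the
      atoms outside \<open>E\<close>, and no atom lies between them. Finite sets are compact, and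
      closed in a T1 space.\<close>
    let ?K = "range w \<inter> E" and ?G = "\<Omega> - (range w - E)"
    have "E \<subseteq> \<Omega>" using sets.sets_into_space[OF E] by (simp add: space_restrict_space)
    moreover have "openin (top_of_set \<Omega>) ?G"
    proof -
      have "open (- (range w - E))" by (intro open_Compl finite_imp_closed) simp
      moreover have "?G = \<Omega> \<inter> - (range w - E)" by blast
      ultimately show ?thesis by (auto simp: openin_open)
    qed
    moreover have "total_variation nrm \<Omega> (atomic_vm w v) (?G - ?K) < ennreal e"
    proof -
      have "total_variation nrm \<Omega> (atomic_vm w v) (?G - ?K) \<le>
          ennreal (\<Sum>m\<in>UNIV. indicator (?G - ?K) (w m) * nrm (v m))"
        by (rule total_variation_atomic_vm_le[OF nrm])
      also have "(\<Sum>m\<in>UNIV. indicator (?G - ?K) (w m) * nrm (v m)) = 0"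
        by (intro sum.neutral) (auto simp: indicator_def)
      finally show ?thesis using e by simp
    qed
    ultimately show "\<exists>K G. compact K \<and> openin (top_of_set \<Omega>) G \<and> K \<subseteq> E \<and> E \<subseteq> G \<and>
        total_variation nrm \<Omega> (atomic_vm w v) (G - K) < ennreal e"
      by (intro exI[of _ ?K] exI[of _ ?G]) (auto intro: finite_imp_compact)
  qed
  moreover have "total_variation nrm \<Omega> (atomic_vm w v) \<Omega> < \<infinity>"
    using total_variation_atomic_vm_le[OF nrm, of \<Omega> w v \<Omega>] ennreal_less_top le_less_trans
    by (metis infinity_ennreal_def)
  ultimately show ?thesis by (simp add: vector_measures_def)
qed

lemma simple_vm_integral_atomic_vm:
  assumes "simple_function (borel_of_subspace \<Omega>) s" "\<And>m. w m \<in> \<Omega>"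
  shows "simple_vm_integral \<Omega> (atomic_vm w v) s = (\<Sum>m\<in>UNIV. s (w m) *\<^sub>R v m)"
proof -
  have fin: "finite (s ` \<Omega>)"
    using assms(1) by (simp add: simple_function_def space_restrict_space)
  have "simple_vm_integral \<Omega> (atomic_vm w v) s =
      (\<Sum>m\<in>UNIV. \<Sum>c\<in>s ` \<Omega>. c *\<^sub>R indicator (s -` {c} \<inter> \<Omega>) (w m) *\<^sub>R v m)"
    unfolding simple_vm_integral_def atomic_vm_def scaleR_sum_right by (rule sum.swap)
  also have "\<dots> = (\<Sum>m\<in>UNIV. \<Sum>c\<in>s ` \<Omega>. if s (w m) = c then c *\<^sub>R v m else 0)"
    using assms(2) by (intro sum.cong) (auto simp: indicator_def)
  also have "\<dots> = (\<Sum>m\<in>UNIV. s (w m) *\<^sub>R v m)"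
    using fin assms(2) by simp
  finally show ?thesis .
qed

lemma vm_integral_atomic_vm:
  fixes nrm :: "'v::euclidean_space \<Rightarrow> real" and v :: "'m::finite \<Rightarrow> 'v" and w :: "'m \<Rightarrow> 'a::t1_space"
  assumes nrm: "vector_norm nrm" and w: "\<And>m. w m \<in> \<Omega>"
    and f: "f \<in> borel_measurable (borel_of_subspace \<Omega>)" "\<And>w. w \<in> \<Omega> \<Longrightarrow> \<bar>f w\<bar> \<le> M"
  shows "vm_integral \<Omega> (atomic_vm w v) f = (\<Sum>m\<in>UNIV. f (w m) *\<^sub>R v m)"
proof -
  \<comment> \<open>The index type \<open>unit\<close> specializes the simultaneous approximation to
    one function.\<close>
  obtain h :: "nat \<Rightarrow> 'a \<Rightarrow> unit \<Rightarrow> int" and r where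
    h: "\<And>k. simple_function (borel_of_subspace \<Omega>) (h k)" and
    lim: "uniform_limit \<Omega> (\<lambda>k w. f (r k (h k w))) f sequentially"
    using uniform_simple_sequence[of "\<lambda>_. f" \<Omega> M] f by metis
  have s: "simple_function (borel_of_subspace \<Omega>) (\<lambda>w. f (r k (h k w)))" for k
    using simple_function_compose1[OF h] .
  have "(\<lambda>k. simple_vm_integral \<Omega> (atomic_vm w v) (\<lambda>w. f (r k (h k w))))
      \<longlonglongrightarrow> vm_integral \<Omega> (atomic_vm w v) f"
    by (rule tendsto_vm_integral[OF nrm atomic_vm_in_vector_measures[OF nrm] s lim])
  moreover have "(\<lambda>k. simple_vm_integral \<Omega> (atomic_vm w v) (\<lambda>w. f (r k (h k w))))
      \<longlonglongrightarrow> (\<Sum>m\<in>UNIV. f (w m) *\<^sub>R v m)"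
    unfolding simple_vm_integral_atomic_vm[OF s w]
    by (intro tendsto_intros tendsto_uniform_limitI[OF lim w])
  ultimately show ?thesis by (rule LIMSEQ_unique)
qed

subsection \<open>The convex set of attainable data values\<close>

text \<open>On each fiber the measure is split into its norm, taken as weight, and a direction of
  norm at most 1. The simple integrals thus are conic combinations of atoms whose total weight is at
  most the variation, and the closed scaled set keeps their limit.\<close>

lemma vm_integrals_mem_scaled_convex:
  fixes f :: "'n::finite \<Rightarrow> 'a::topological_space \<Rightarrow> real" and C :: "((real ^ 'd) ^ 'n) set"
  assumes nrm: "vector_norm nrm" and \<mu>: "\<mu> \<in> vector_measures nrm \<Omega>"
    and f: "\<And>n. f n \<in> borel_measurable (borel_of_subspace \<Omega>)" "\<And>n w. w \<in> \<Omega> \<Longrightarrow> \<bar>f n w\<bar> \<le> M"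
    and C: "convex C" "compact C" "0 \<in> C"
    and atoms: "\<And>w u. w \<in> \<Omega> \<Longrightarrow> nrm u \<le> 1 \<Longrightarrow> (\<chi> n. f n w *\<^sub>R u) \<in> C"
  shows "(\<chi> n. vm_integral \<Omega> \<mu> (f n)) \<in> (*\<^sub>R) (enn2real (total_variation nrm \<Omega> \<mu> \<Omega>)) ` C"
proof -
  have ca: "countably_additive_vm \<Omega> \<mu>" and tv: "total_variation nrm \<Omega> \<mu> \<Omega> < \<infinity>"
    using \<mu> by (auto simp: vector_measures_def)
  obtain h :: "nat \<Rightarrow> 'a \<Rightarrow> 'n \<Rightarrow> int" and r where
    h: "\<And>k. simple_function (borel_of_subspace \<Omega>) (h k)"
    and r: "\<And>k b. b \<in> h k ` \<Omega> \<Longrightarrow> r k b \<in> \<Omega>"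
    and lim: "\<And>n. uniform_limit \<Omega> (\<lambda>k w. f n (r k (h k w))) (f n) sequentially"
    using uniform_simple_sequence[of f \<Omega> M, OF f] by blast
  have s: "simple_function (borel_of_subspace \<Omega>) (\<lambda>w. f n (r k (h k w)))" for n k
    using simple_function_compose1[OF h] .
  let ?V = "(*\<^sub>R) (enn2real (total_variation nrm \<Omega> \<mu> \<Omega>)) ` C"
  define z where "z k = (\<chi> n. simple_vm_integral \<Omega> \<mu> (\<lambda>w. f n (r k (h k w))))" for k
  have "z \<longlonglongrightarrow> (\<chi> n. vm_integral \<Omega> \<mu> (f n))"
    unfolding z_def using tendsto_vm_integral[OF nrm \<mu> s lim] by (intro tendsto_vec_lambda)
  moreover have "z k \<in> ?V" for k
  proof -
    let ?p = "\<lambda>b. \<mu> (h k -` {b} \<inter> \<Omega>)"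
    have fin: "finite (h k ` \<Omega>)"
      using h[of k] by (simp add: simple_function_def space_restrict_space)
    \<comment> \<open>For a fiber of measure zero the weight is 0 and both sides vanish.\<close>
    have p: "nrm (?p b) *\<^sub>R ((1 / nrm (?p b)) *\<^sub>R ?p b) = ?p b" for b
      using vector_normD(2)[OF nrm, of "?p b"] by (cases "?p b = 0") auto
    have "z k = (\<Sum>b\<in>h k ` \<Omega>. \<chi> n. f n (r k b) *\<^sub>R ?p b)"
      unfolding z_def using simple_vm_integral_comp[OF ca h[of k], of "\<lambda>b. f _ (r k b)"]
      by (simp add: vec_eq_iff)
    also have "\<dots> = (\<Sum>b\<in>h k ` \<Omega>. nrm (?p b) *\<^sub>R (\<chi> n. f n (r k b) *\<^sub>R ((1 / nrm (?p b)) *\<^sub>R ?p b)))"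
      by (intro sum.cong refl, subst p[symmetric]) (simp add: vec_eq_iff)
    also have "\<dots> \<in> ?V"
    proof (rule sum_scaleR_mem_scaled_convex[OF C(1,3) fin])
      show "(\<Sum>b\<in>h k ` \<Omega>. nrm (?p b)) \<le> enn2real (total_variation nrm \<Omega> \<mu> \<Omega>)"
        by (rule sum_fibers_le_total_variation[OF nrm tv h])
      fix b assume b: "b \<in> h k ` \<Omega>"
      show "0 \<le> nrm (?p b)" by (rule vector_normD(1)[OF nrm])
      show "(\<chi> n. f n (r k b) *\<^sub>R ((1 / nrm (?p b)) *\<^sub>R ?p b)) \<in> C"
        using r[OF b] vector_normD(1)[OF nrm, of "?p b"]
        by (intro atoms) (auto simp: vector_normD(3)[OF nrm])
    qed
    finally show ?thesis .
  qed
  moreover have "closed ?V"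
    using C(2) by (intro compact_imp_closed compact_scaling)
  ultimately show ?thesis by (blast intro: closed_sequentially)
qed

section \<open>Features vanishing at infinity\<close>

text \<open>A compact subset of the product outside which \<open>\<phi>\<close> is small projects to
  a compact subset of \<open>\<Omega>\<close> that does the same for the slice.\<close>

lemma C0_on_slice:
  assumes "C0_on (X \<times> \<Omega>) (\<lambda>(x, w). \<phi> x w)" "x \<in> X"
  shows "C0_on \<Omega> (\<phi> x)"
  unfolding C0_on_def
proof (intro conjI allI impI)
  have "continuous_on (X \<times> \<Omega>) (\<lambda>(x, w). \<phi> x w)" using assms(1) by (simp add: C0_on_def)
  then have "continuous_on \<Omega> (\<lambda>w. (\<lambda>(x, w). \<phi> x w) (x, w))"
    by (rule continuous_on_compose2) (use assms(2) in \<open>auto intro: continuous_intros\<close>)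
  then show "continuous_on \<Omega> (\<phi> x)" by simp
  fix e :: real assume "0 < e"
  then obtain K where K: "compact K" "K \<subseteq> X \<times> \<Omega>" "\<forall>p\<in>X \<times> \<Omega> - K. \<bar>case p of (x, w) \<Rightarrow> \<phi> x w\<bar> < e"
    using assms(1) unfolding C0_on_def by blast
  have "compact (snd ` K)" by (intro compact_continuous_image continuous_intros K)
  moreover have "\<bar>\<phi> x w\<bar> < e" if "w \<in> \<Omega> - snd ` K" for w
    using K(3)[rule_format, of "(x, w)"] that assms(2) by force
  ultimately show "\<exists>K. compact K \<and> K \<subseteq> \<Omega> \<and> (\<forall>w\<in>\<Omega> - K. \<bar>\<phi> x w\<bar> < e)"
    using K(2) by (intro exI[of _ "snd ` K"]) auto
qed

text \<open>Adjoining \<open>0\<close> adds the value at the point at infinity of \<open>\<Omega>\<close>.\<close>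

lemma compact_insert_zero_C0_image:
  fixes f :: "'n::finite \<Rightarrow> 'a::topological_space \<Rightarrow> real"
  assumes "\<And>n. C0_on \<Omega> (f n)"
  shows "compact (insert 0 ((\<lambda>w. \<chi> n. f n w) ` \<Omega>))"
proof (rule compactI)
  fix \<C> :: "(real ^ 'n) set set"
  assume op: "\<forall>B\<in>\<C>. open B" and cover: "insert 0 ((\<lambda>w. \<chi> n. f n w) ` \<Omega>) \<subseteq> \<Union>\<C>"
  obtain U where U: "U \<in> \<C>" "0 \<in> U" using cover by auto
  then obtain e where e: "0 < e" "ball 0 e \<subseteq> U" using op by (meson openE)
  \<comment> \<open>If all coordinates are below \<open>d\<close> in absolute value, their sum is
    below \<open>e\<close>, and it dominates the norm.\<close>
  define d where "d = e / real CARD('n)"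
  have d: "0 < d" using e(1) by (simp add: d_def)
  then have "\<forall>n. \<exists>K. compact K \<and> K \<subseteq> \<Omega> \<and> (\<forall>w\<in>\<Omega> - K. \<bar>f n w\<bar> < d)"
    using assms unfolding C0_on_def by blast
  then obtain K where K: "\<And>n. compact (K n)" "\<And>n. K n \<subseteq> \<Omega>" "\<And>n w. w \<in> \<Omega> - K n \<Longrightarrow> \<bar>f n w\<bar> < d"
    by metis
  let ?K = "\<Union>n. K n"
  have "continuous_on \<Omega> (\<lambda>w. \<chi> n. f n w)"
    using assms by (intro continuous_on_vec_lambda) (simp add: C0_on_def)
  \<comment> \<open>Finitely many members of the cover suffice for the values on \<open>?K\<close>;
    all other values fall into \<open>U\<close>.\<close>
  then have "compact ((\<lambda>w. \<chi> n. f n w) ` ?K)"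
    using K by (intro compact_continuous_image compact_UN) (auto intro: continuous_on_subset)
  moreover have "(\<lambda>w. \<chi> n. f n w) ` ?K \<subseteq> \<Union>\<C>" using cover K(2) by blast
  ultimately obtain \<D> where D: "\<D> \<subseteq> \<C>" "finite \<D>" "(\<lambda>w. \<chi> n. f n w) ` ?K \<subseteq> \<Union>\<D>"
    using op by (meson compactE)
  have "(\<chi> n. f n w) \<in> U" if w: "w \<in> \<Omega> - ?K" for w
  proof -
    have "norm (\<chi> n. f n w) \<le> (\<Sum>n\<in>UNIV. \<bar>f n w\<bar>)" using norm_le_l1_cart[of "\<chi> n. f n w"] by simp
    also have "\<dots> < of_nat CARD('n) * d"
      using K(3) w by (intro sum_bounded_above_strict) auto
    finally show ?thesis using e by (auto simp: d_def)
  qed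
  then show "\<exists>\<D>\<subseteq>\<C>. finite \<D> \<and> insert 0 ((\<lambda>w. \<chi> n. f n w) ` \<Omega>) \<subseteq> \<Union>\<D>"
    using U D by (intro exI[of _ "insert U \<D>"]) blast
qed

section \<open>Coercive losses\<close>

text \<open>Coercivity gives a lower bound outside a ball, compactness and continuity one
  inside.\<close>

lemma coercive_bounded_below:
  fixes f :: "'a::euclidean_space \<Rightarrow> real"
  assumes "coercive f" "continuous_on UNIV f"
  obtains m where "\<And>z. m \<le> f z"
proof -
  have "\<forall>\<^sub>F z in at_infinity. 0 \<le> f z"
    using assms(1) unfolding coercive_def filterlim_at_top by blast
  then obtain b where b: "\<And>z. b \<le> norm z \<Longrightarrow> 0 \<le> f z"
    unfolding eventually_at_infinity by blast
  have "\<exists>u\<in>cball 0 \<bar>b\<bar>. \<forall>z\<in>cball 0 \<bar>b\<bar>. f u \<le> f z"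
    by (intro continuous_attains_inf continuous_on_subset[OF assms(2)]) auto
  then obtain u where u: "\<And>z. norm z \<le> \<bar>b\<bar> \<Longrightarrow> f u \<le> f z"
    unfolding mem_cball_0 Ball_def by blast
  then have "min 0 (f u) \<le> f z" for z
    using b[of z] u[of z] by (cases "norm z \<le> \<bar>b\<bar>") (auto simp: min_le_iff_disj)
  then show thesis by (rule that)
qed

text \<open>If \<open>z\<close> is large, so is one of its components, and the loss of that
  component outweighs the lower bounds of all the others.\<close>

lemma coercive_sum_gt_outside_ball:
  fixes l :: "'n::finite \<Rightarrow> 'v::euclidean_space \<Rightarrow> real"
  assumes co: "\<And>n. coercive (l n)" and cont: "\<And>n. continuous_on UNIV (l n)"
  obtains R where "\<And>z :: 'v ^ 'n. R < norm z \<Longrightarrow> c < (\<Sum>n\<in>UNIV. l n (z $ n))"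
proof -
  have "\<exists>m. \<forall>z. m \<le> l n z" for n
    using coercive_bounded_below[OF co cont] by metis
  then obtain m where m: "\<And>n z. m n \<le> l n z" by metis
  \<comment> \<open>With the other terms at their lower bounds, term \<open>n\<close> must exceed
    \<open>c - sum m UNIV + m n\<close>; the summand 1 makes this strict.\<close>
  have "\<exists>b. \<forall>z. b \<le> norm z \<longrightarrow> c - sum m UNIV + m n + 1 \<le> l n z" for n
    using co[of n] unfolding coercive_def filterlim_at_top eventually_at_infinity by blast
  then obtain b where b: "\<And>n z. b n \<le> norm z \<Longrightarrow> c - sum m UNIV + m n + 1 \<le> l n z" by metis
  show thesis
  proof (rule that[of "sum b UNIV"])
    fix z :: "'v ^ 'n" assume R: "sum b UNIV < norm z"
    have "norm z \<le> (\<Sum>n\<in>UNIV. norm (z $ n))"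
      unfolding norm_vec_def by (rule L2_set_le_sum) simp
    with R have "\<not> (\<forall>n. norm (z $ n) \<le> b n)" using sum_mono[of UNIV "\<lambda>n. norm (z $ n)" b] by fastforce
    then obtain n where n: "b n \<le> norm (z $ n)" by (meson linear)
    have "sum m (UNIV - {n}) \<le> (\<Sum>i\<in>UNIV - {n}. l i (z $ i))" using m by (intro sum_mono)
    moreover have "sum m UNIV = m n + sum m (UNIV - {n})"
      "(\<Sum>i\<in>UNIV. l i (z $ i)) = l n (z $ n) + (\<Sum>i\<in>UNIV - {n}. l i (z $ i))"
      by (simp_all add: sum.remove)
    ultimately show "c < (\<Sum>n\<in>UNIV. l n (z $ n))" using b[OF n] by linarith
  qed
qed

section \<open>Atoms and their convex hull\<close>

text \<open>The data values of point masses at \<open>w\<close> with weight \<open>u\<close>.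
  Written as the image of a product, with 0 adjoined for the point at infinity, the set is visibly
  compact when the features vanish at infinity.\<close>

definition feature_atoms ::
  "('v::real_normed_vector \<Rightarrow> real) \<Rightarrow> 'a set \<Rightarrow> ('n::finite \<Rightarrow> 'a \<Rightarrow> real) \<Rightarrow> ('v ^ 'n) set" where
  "feature_atoms nrm \<Omega> f =
     (\<lambda>(r, u). \<chi> n. (r $ n) *\<^sub>R u) ` (insert 0 ((\<lambda>w. \<chi> n. f n w) ` \<Omega>) \<times> {u. nrm u \<le> 1})"

lemma feature_atomsI:
  assumes "w \<in> \<Omega>" "nrm u \<le> 1"
  shows "(\<chi> n. f n w *\<^sub>R u) \<in> feature_atoms nrm \<Omega> f"
  unfolding feature_atoms_def
  using assms by (intro image_eqI[of _ _ "(\<chi> n. f n w, u)"]) auto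

text \<open>The adjoined feature value 0 yields only the atom 0, so a nonzero atom comes from a
  point of \<open>\<Omega>\<close>.\<close>

lemma feature_atomsE:
  assumes "z \<in> feature_atoms nrm \<Omega> f" "z \<noteq> 0"
  obtains w u where "w \<in> \<Omega>" "nrm u \<le> 1" "z = (\<chi> n. f n w *\<^sub>R u)"
proof -
  obtain r u where r: "r = 0 \<or> (\<exists>w\<in>\<Omega>. r = (\<chi> n. f n w))" and u: "nrm u \<le> 1"
    and z: "z = (\<chi> n. (r $ n) *\<^sub>R u)"
    using assms(1) unfolding feature_atoms_def by auto
  have "r \<noteq> 0" using assms(2) z by (auto simp: vec_eq_iff)
  then obtain w where "w \<in> \<Omega>" "r = (\<chi> n. f n w)" using r by blast
  then show thesis using that u z by simp
qed

lemma zero_mem_feature_atoms: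
  assumes "vector_norm nrm"
  shows "0 \<in> feature_atoms nrm \<Omega> f"
  unfolding feature_atoms_def
  using vector_normD(2)[OF assms, of 0]
  by (intro image_eqI[of _ _ "(0, 0)"]) (auto simp: vec_eq_iff)

text \<open>The sign is absorbed by \<open>u\<close>, since the unit ball of \<open>nrm\<close> is
  symmetric.\<close>

lemma uminus_mem_feature_atoms:
  assumes "vector_norm nrm" "z \<in> feature_atoms nrm \<Omega> f"
  shows "- z \<in> feature_atoms nrm \<Omega> f"
proof -
  obtain r u where r: "r \<in> insert 0 ((\<lambda>w. \<chi> n. f n w) ` \<Omega>)" and u: "nrm u \<le> 1"
    and z: "z = (\<chi> n. (r $ n) *\<^sub>R u)"
    using assms(2) unfolding feature_atoms_def by (elim imageE SigmaE) auto
  have "nrm (- u) \<le> 1" using u vector_normD(3)[OF assms(1), of "- 1" u] by simp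
  then show ?thesis
    unfolding feature_atoms_def z using r
    by (intro image_eqI[of _ _ "(r, - u)"]) (auto simp: vec_eq_iff)
qed

lemma compact_feature_atoms:
  fixes nrm :: "'v::euclidean_space \<Rightarrow> real"
  assumes "vector_norm nrm" "\<And>n. C0_on \<Omega> (f n)"
  shows "compact (feature_atoms nrm \<Omega> f)"
  unfolding feature_atoms_def split_def
  by (intro compact_continuous_image compact_Times compact_insert_zero_C0_image
      compact_vector_norm_ball assms continuous_on_vec_lambda continuous_intros)

lemma uminus_mem_convex_hull_feature_atoms:
  assumes "vector_norm nrm" "z \<in> convex hull feature_atoms nrm \<Omega> f"
  shows "- z \<in> convex hull feature_atoms nrm \<Omega> f"
proof -
  have "- z \<in> uminus ` (convex hull feature_atoms nrm \<Omega> f)" using assms(2) by simp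
  also have "\<dots> = convex hull (uminus ` feature_atoms nrm \<Omega> f)"
    by (intro convex_hull_linear_image linear_uminus)
  also have "\<dots> \<subseteq> convex hull feature_atoms nrm \<Omega> f"
    by (intro hull_mono image_subsetI uminus_mem_feature_atoms[OF assms(1)])
  finally show ?thesis .
qed

text \<open>
  The bound \<open>N d\<close> on the number of neurons is the dimension of the space of data values
  \<open>(f(x\<^sub>1), \<dots>, f(x\<^sub>N))\<close>.
\<close>

lemma feature_atoms_representation:
  fixes f :: "'n::finite \<Rightarrow> 'a \<Rightarrow> real" and nrm :: "real ^ 'd \<Rightarrow> real"
  assumes nrm: "vector_norm nrm" and "\<Omega> \<noteq> {}" and t: "0 \<le> t"
    and k: "k \<in> convex hull feature_atoms nrm \<Omega> f"
  obtains w :: "'n \<times> 'd \<Rightarrow> 'a" and v :: "'n \<times> 'd \<Rightarrow> real ^ 'd"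
  where "\<And>m. w m \<in> \<Omega>" "t *\<^sub>R k = (\<chi> n. \<Sum>m\<in>UNIV. f n (w m) *\<^sub>R v m)" "(\<Sum>m\<in>UNIV. nrm (v m)) \<le> t"
proof -
  obtain S c where S: "finite S" "S \<subseteq> feature_atoms nrm \<Omega> f" "\<And>x. x \<in> S \<Longrightarrow> 0 \<le> c x"
    "sum c S = 1" "(\<Sum>x\<in>S. c x *\<^sub>R x) = k"
    using k unfolding convex_hull_explicit by (elim CollectE exE conjE) (rule that; simp)
  have nonneg: "0 \<le> t * c x" if "x \<in> S" for x using t S(3)[OF that] by simp
  obtain B c' where B: "B \<subseteq> S" "independent B" "\<And>x. x \<in> B \<Longrightarrow> 0 \<le> c' x"
    "(\<Sum>x\<in>B. c' x *\<^sub>R x) = (\<Sum>x\<in>S. (t * c x) *\<^sub>R x)" "sum c' B \<le> (\<Sum>x\<in>S. t * c x)"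
    by (rule conic_combination_independent[of S "\<lambda>x. t * c x"]) (rule S(1), erule nonneg, rule that)
  have tk: "(\<Sum>x\<in>B. c' x *\<^sub>R x) = t *\<^sub>R k"
    by (simp add: B(4) S(5)[symmetric] scaleR_sum_right)
  have sum: "sum c' B \<le> t" using B(5) S(4) by (simp add: sum_distrib_left[symmetric])
  \<comment> \<open>The dimension of \<open>(real ^ 'd) ^ 'n\<close> bounds the number of
    independent vectors, so distinct pairs in \<open>'n \<times> 'd\<close> can label them.\<close>
  have finB: "finite B" and "card B \<le> CARD('n \<times> 'd)"
    using independent_bound[OF B(2)] by (simp_all add: card_prod)
  then obtain p :: "(real ^ 'd) ^ 'n \<Rightarrow> 'n \<times> 'd" where p: "inj_on p B"
    using card_le_inj[OF finB finite] by blast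
  have "\<exists>w u. w \<in> \<Omega> \<and> nrm u \<le> 1 \<and> x = (\<chi> n. f n w *\<^sub>R u)" if "x \<in> B" for x
  proof -
    \<comment> \<open>Independence excludes 0, so no vector of \<open>B\<close> stems from the point
      at infinity.\<close>
    have "x \<noteq> 0" using that B(2) dependent_zero by blast
    then show ?thesis using that B(1) S(2) feature_atomsE[of x nrm \<Omega> f] by blast
  qed
  then obtain W U where WU: "\<And>x. x \<in> B \<Longrightarrow> W x \<in> \<Omega>" "\<And>x. x \<in> B \<Longrightarrow> nrm (U x) \<le> 1"
    "\<And>x. x \<in> B \<Longrightarrow> x = (\<chi> n. f n (W x) *\<^sub>R U x)"
    by metis
  obtain w0 where w0: "w0 \<in> \<Omega>" using \<open>\<Omega> \<noteq> {}\<close> by blast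
  define q where "q = inv_into B p"
  \<comment> \<open>Labels that belong to no vector of \<open>B\<close> get the dummy point
    \<open>w0\<close> with weight 0, which pads the sum to exactly \<open>N d\<close> terms.\<close>
  define w where "w m = (if m \<in> p ` B then W (q m) else w0)" for m
  define v where "v m = (if m \<in> p ` B then c' (q m) *\<^sub>R U (q m) else 0)" for m
  have q: "q (p x) = x" if "x \<in> B" for x using that p by (simp add: q_def)
  have sum_UNIV: "(\<Sum>m\<in>UNIV. F m) = (\<Sum>x\<in>B. F (p x))" if "\<And>m. m \<notin> p ` B \<Longrightarrow> F m = 0"
    for F :: "'n \<times> 'd \<Rightarrow> 'b::comm_monoid_add"
  proof -
    have "(\<Sum>m\<in>UNIV. F m) = (\<Sum>m\<in>p ` B. F m)"
      using that by (intro sum.mono_neutral_right) auto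
    then show ?thesis by (simp add: sum.reindex[OF p])
  qed
  show thesis
  proof (rule that[of w v])
    show "w m \<in> \<Omega>" for m using WU(1) w0 q by (auto simp: w_def)
    have "(\<Sum>m\<in>UNIV. f n (w m) *\<^sub>R v m) = (t *\<^sub>R k) $ n" for n
    proof -
      have "(\<Sum>m\<in>UNIV. f n (w m) *\<^sub>R v m) = (\<Sum>x\<in>B. f n (w (p x)) *\<^sub>R v (p x))"
        by (rule sum_UNIV) (simp add: v_def)
      also have "\<dots> = (\<Sum>x\<in>B. c' x *\<^sub>R x $ n)"
      proof (rule sum.cong[OF refl])
        fix x assume x: "x \<in> B"
        have "x $ n = f n (W x) *\<^sub>R U x" by (subst WU(3)[OF x]) simp
        then show "f n (w (p x)) *\<^sub>R v (p x) = c' x *\<^sub>R x $ n" using x q[OF x] by (simp add: w_def v_def)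
      qed
      also have "\<dots> = (t *\<^sub>R k) $ n" by (simp add: tk[symmetric])
      finally show ?thesis .
    qed
    then show "t *\<^sub>R k = (\<chi> n. \<Sum>m\<in>UNIV. f n (w m) *\<^sub>R v m)" by (simp add: vec_eq_iff)
    have "(\<Sum>m\<in>UNIV. nrm (v m)) = (\<Sum>x\<in>B. nrm (v (p x)))"
      using vector_normD(2)[OF nrm, of 0] by (intro sum_UNIV) (simp add: v_def)
    also have "\<dots> \<le> sum c' B"
    proof (rule sum_mono)
      fix x assume x: "x \<in> B"
      have "c' x * nrm (U x) \<le> c' x * 1" using WU(2)[OF x] B(3)[OF x] by (rule mult_left_mono)
      then show "nrm (v (p x)) \<le> c' x"
        using x q[OF x] B(3)[OF x] by (simp add: v_def vector_normD(3)[OF nrm])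
    qed
    also note sum
    finally show "(\<Sum>m\<in>UNIV. nrm (v m)) \<le> t" .
  qed
qed

subsection \<open>Existence of an atomic minimizer\<close>

lemma vv_RKBS_norm_A_op_le:
  assumes "\<mu> \<in> vector_measures nrm \<Omega>"
  shows "vv_RKBS_norm nrm X \<Omega> \<phi> (A_op X \<Omega> \<phi> \<mu>) \<le> enn2real (total_variation nrm \<Omega> \<mu> \<Omega>)"
  unfolding vv_RKBS_norm_def using assms
  by (intro cINF_lower bdd_belowI[of _ 0]) auto

text \<open>After division by a positive \<open>lam\<close>, a bound for every representing measure
  passes to the infimum. For \<open>lam = 0\<close> a single representing measure is enough.\<close>

lemma le_add_mult_vv_RKBS_norm:
  assumes "g \<in> vv_RKBS nrm X \<Omega> \<phi>" "0 \<le> lam"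
    and le: "\<And>\<mu>. \<mu> \<in> vector_measures nrm \<Omega> \<Longrightarrow> g = A_op X \<Omega> \<phi> \<mu> \<Longrightarrow>
      a \<le> b + lam * enn2real (total_variation nrm \<Omega> \<mu> \<Omega>)"
  shows "a \<le> b + lam * vv_RKBS_norm nrm X \<Omega> \<phi> g"
proof (cases "lam = 0")
  case True
  then show ?thesis using assms(1) le by (auto simp: vv_RKBS_def)
next
  case False
  with assms(2) have lam: "0 < lam" by simp
  have "(a - b) / lam \<le> vv_RKBS_norm nrm X \<Omega> \<phi> g"
    unfolding vv_RKBS_norm_def
  proof (rule cINF_greatest)
    show "{\<mu> \<in> vector_measures nrm \<Omega>. g = A_op X \<Omega> \<phi> \<mu>} \<noteq> {}"
      using assms(1) by (auto simp: vv_RKBS_def)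
    fix \<mu> assume "\<mu> \<in> {\<mu> \<in> vector_measures nrm \<Omega>. g = A_op X \<Omega> \<phi> \<mu>}"
    then show "(a - b) / lam \<le> enn2real (total_variation nrm \<Omega> \<mu> \<Omega>)"
      using le[of \<mu>] lam by (simp add: pos_divide_le_eq algebra_simps)
  qed
  then show ?thesis using lam by (simp add: pos_divide_le_eq algebra_simps)
qed

lemma C0_on_measurable_bounded:
  assumes "C0_on \<Omega> f"
  shows "f \<in> borel_measurable (borel_of_subspace \<Omega>)" "\<exists>M. \<forall>w\<in>\<Omega>. \<bar>f w\<bar> \<le> M"
proof -
  have cont: "continuous_on \<Omega> f" using assms by (simp add: C0_on_def)
  then show "f \<in> borel_measurable (borel_of_subspace \<Omega>)" by (rule borel_measurable_continuous_on_restrict)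
  obtain K where K: "compact K" "K \<subseteq> \<Omega>" "\<And>w. w \<in> \<Omega> - K \<Longrightarrow> \<bar>f w\<bar> < 1"
    using assms unfolding C0_on_def by (metis zero_less_one)
  have "bounded (f ` K)"
    using K by (intro compact_imp_bounded compact_continuous_image continuous_on_subset[OF cont])
  then obtain M where M: "\<And>w. w \<in> K \<Longrightarrow> \<bar>f w\<bar> \<le> M" unfolding bounded_iff by auto
  have "\<forall>w\<in>\<Omega>. \<bar>f w\<bar> \<le> max 1 M"
    using K(3) M by (metis DiffI less_imp_le max.coboundedI1 max.coboundedI2)
  then show "\<exists>M. \<forall>w\<in>\<Omega>. \<bar>f w\<bar> \<le> M" by blast
qed

text \<open>The minimizing pair \<open>t\<close>, \<open>k\<close> is realized by an atomic measure
  of variation at most \<open>t\<close>. Conversely, each measure representing a competitor gives an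
  admissible pair with its own variation as \<open>t\<close>, so the competitor does no
  better.\<close>

lemma atomic_minimizer_exists:
  fixes nrm :: "real ^ 'd \<Rightarrow> real" and \<Omega> :: "'a::t1_space set" and xs :: "'n::finite \<Rightarrow> 'x"
  assumes nrm: "vector_norm nrm" and \<Omega>: "\<Omega> \<noteq> {}"
    and C0: "\<And>x. x \<in> X \<Longrightarrow> C0_on \<Omega> (\<phi> x)" and xs: "\<And>n. xs n \<in> X"
    and cont: "\<And>y. continuous_on UNIV (\<lambda>z. L z y)" and co: "\<And>y. coercive (\<lambda>z. L z y)"
    and lam: "0 \<le> lam"
  obtains w :: "'n \<times> 'd \<Rightarrow> 'a" and v :: "'n \<times> 'd \<Rightarrow> real ^ 'd" where "\<And>m. w m \<in> \<Omega>"
    "\<And>g. g \<in> vv_RKBS nrm X \<Omega> \<phi> \<Longrightarrow>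
      learning_objective nrm X \<Omega> \<phi> L lam xs ys (A_op X \<Omega> \<phi> (atomic_vm w v)) \<le>
      learning_objective nrm X \<Omega> \<phi> L lam xs ys g"
proof -
  define f where "f n = \<phi> (xs n)" for n
  have f: "C0_on \<Omega> (f n)" for n unfolding f_def by (intro C0 xs)
  have "\<forall>n. \<exists>M. \<forall>w\<in>\<Omega>. \<bar>f n w\<bar> \<le> M" using C0_on_measurable_bounded(2)[OF f] by blast
  then obtain M where M: "\<And>n w. w \<in> \<Omega> \<Longrightarrow> \<bar>f n w\<bar> \<le> M n" by metis
  \<comment> \<open>The data are finite in number, so their features have a common bound.\<close>
  have M': "\<bar>f n w\<bar> \<le> Max (range M)" if "w \<in> \<Omega>" for n w
    using M[OF that, of n] by (rule order_trans) simp
  note meas = C0_on_measurable_bounded(1)[OF f]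
  define C where "C = convex hull feature_atoms nrm \<Omega> f"
  have C: "convex C" "compact C" "0 \<in> C"
    unfolding C_def
    by (intro convex_convex_hull compact_convex_hull compact_feature_atoms hull_inc nrm f
        zero_mem_feature_atoms)+
  have C': "- z \<in> C" if "z \<in> C" for z
    using uminus_mem_convex_hull_feature_atoms[OF nrm] that unfolding C_def .
  define F where "F z = 1 / real CARD('n) * (\<Sum>n\<in>UNIV. L (z $ n) (ys n))" for z :: "(real ^ 'd) ^ 'n"
  have obj: "learning_objective nrm X \<Omega> \<phi> L lam xs ys g =
      F (\<chi> n. g (xs n)) + lam * vv_RKBS_norm nrm X \<Omega> \<phi> g" for g
    by (simp add: learning_objective_def F_def)
  have "continuous_on UNIV F"
    unfolding F_def by (intro continuous_intros continuous_on_compose2[OF cont]) auto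
  moreover obtain R where "\<And>z :: (real ^ 'd) ^ 'n. R < norm z \<Longrightarrow>
      (\<Sum>n\<in>UNIV. L 0 (ys n)) < (\<Sum>n\<in>UNIV. L (z $ n) (ys n))"
    using coercive_sum_gt_outside_ball[of "\<lambda>n z. L z (ys n)", OF co cont] by blast
  then have "\<And>z. R < norm z \<Longrightarrow> F 0 < F z" by (simp add: F_def divide_strict_right_mono)
  ultimately obtain t k where t: "0 \<le> t" and k: "k \<in> C" and
    min: "\<And>t' k'. 0 \<le> t' \<Longrightarrow> k' \<in> C \<Longrightarrow> F (t *\<^sub>R k) + lam * t \<le> F (t' *\<^sub>R k') + lam * t'"
    using penalized_minimum_exists[OF C(1,2) _ C', of F R lam] C(3) lam by blast
  obtain w :: "'n \<times> 'd \<Rightarrow> 'a" and v :: "'n \<times> 'd \<Rightarrow> real ^ 'd" where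
    w: "\<And>m. w m \<in> \<Omega>" and tk: "t *\<^sub>R k = (\<chi> n. \<Sum>m\<in>UNIV. f n (w m) *\<^sub>R v m)"
    and v: "(\<Sum>m\<in>UNIV. nrm (v m)) \<le> t"
    using feature_atoms_representation[OF nrm \<Omega> t k[unfolded C_def]] by blast
  show thesis
  proof (rule that[of w v, OF w])
    fix g assume g: "g \<in> vv_RKBS nrm X \<Omega> \<phi>"
    let ?\<mu> = "atomic_vm w v"
    let ?f = "A_op X \<Omega> \<phi> ?\<mu>"
    \<comment> \<open>An upper bound by \<open>t\<close> is enough: the norm is an infimum, and
      \<open>?\<mu>\<close> is one of the representing measures.\<close>
    have "vv_RKBS_norm nrm X \<Omega> \<phi> ?f \<le> enn2real (total_variation nrm \<Omega> ?\<mu> \<Omega>)"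
      by (intro vv_RKBS_norm_A_op_le atomic_vm_in_vector_measures nrm)
    also have "\<dots> \<le> (\<Sum>m\<in>UNIV. nrm (v m))"
      using total_variation_atomic_vm_le[OF nrm, of \<Omega> w v \<Omega>] w vector_normD(1)[OF nrm]
      by (intro enn2real_leI) (auto intro: sum_nonneg)
    also note v
    finally have "lam * vv_RKBS_norm nrm X \<Omega> \<phi> ?f \<le> lam * t" using lam by (rule mult_left_mono)
    moreover have "(\<chi> n. ?f (xs n)) = t *\<^sub>R k"
      using vm_integral_atomic_vm[OF nrm w meas M', where v = v] xs
      by (simp add: tk A_op_def f_def)
    ultimately have "learning_objective nrm X \<Omega> \<phi> L lam xs ys ?f \<le> F (t *\<^sub>R k) + lam * t"
      by (simp add: obj)
    also have "\<dots> \<le> F (\<chi> n. g (xs n)) + lam * vv_RKBS_norm nrm X \<Omega> \<phi> g"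
    proof (rule le_add_mult_vv_RKBS_norm[OF g lam])
      fix \<mu> assume \<mu>: "\<mu> \<in> vector_measures nrm \<Omega>" and g: "g = A_op X \<Omega> \<phi> \<mu>"
      have "(\<chi> n. vm_integral \<Omega> \<mu> (f n)) \<in> (*\<^sub>R) (enn2real (total_variation nrm \<Omega> \<mu> \<Omega>)) ` C"
        by (rule vm_integrals_mem_scaled_convex[OF nrm \<mu> meas M' C(1-3)])
          (auto simp: C_def intro!: hull_inc feature_atomsI)
      moreover have "(\<chi> n. g (xs n)) = (\<chi> n. vm_integral \<Omega> \<mu> (f n))"
        using xs by (simp add: g A_op_def f_def)
      ultimately show "F (t *\<^sub>R k) + lam * t \<le>
          F (\<chi> n. g (xs n)) + lam * enn2real (total_variation nrm \<Omega> \<mu> \<Omega>)"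
        using min by auto
    qed
    finally show "learning_objective nrm X \<Omega> \<phi> L lam xs ys ?f \<le>
        learning_objective nrm X \<Omega> \<phi> L lam xs ys g" by (simp add: obj)
  qed
qed

section \<open>The minimizer as a neural network\<close>

theorem corollary5p1:
  fixes X :: "(real ^ 'dx) set"
    and \<Omega>' :: "(real ^ 'dx) set"
    and \<Omega> :: "((real ^ 'dx) \<times> real) set"
    and nrm :: "real ^ 'd \<Rightarrow> real"
    and \<sigma> :: "real \<Rightarrow> real"
    and \<beta> :: "(real ^ 'dx) \<times> real \<Rightarrow> real"
    and \<phi> :: "real ^ 'dx \<Rightarrow> (real ^ 'dx) \<times> real \<Rightarrow> real"
    and L :: "real ^ 'd \<Rightarrow> real ^ 'd \<Rightarrow> real"
    and xs :: "'n::finite \<Rightarrow> real ^ 'dx"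
    and ys :: "'n \<Rightarrow> real ^ 'd"
    and lam :: real
  assumes "vector_norm nrm"
    and "compact X"
    and "\<Omega>' \<noteq> {}" and "locally_compact_space (top_of_set \<Omega>')"
    and "\<Omega> = \<Omega>' \<times> UNIV"
    and "\<sigma> \<in> borel_measurable borel"
    and "\<beta> \<in> borel_measurable (borel_of_subspace \<Omega>)"
    and "\<And>w. w \<in> \<Omega> \<Longrightarrow> 0 < \<beta> w"
    and "\<And>x \<omega> b. x \<in> X \<Longrightarrow> (\<omega>, b) \<in> \<Omega> \<Longrightarrow> \<phi> x (\<omega>, b) = \<sigma> (\<omega> \<bullet> x + b) * \<beta> (\<omega>, b)"
    and "C0_on (X \<times> \<Omega>) (\<lambda>(x, w). \<phi> x w)"
    and "\<And>n. xs n \<in> X"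
    and "\<And>y. convex_on UNIV (\<lambda>z. L z y)"
    and "\<And>y. coercive (\<lambda>z. L z y)"
    and "\<And>y. lower_semicontinuous (\<lambda>z. L z y)"
    and "0 \<le> lam"
  shows "\<exists>f \<in> vv_RKBS nrm X \<Omega> \<phi>.
     (\<forall>g \<in> vv_RKBS nrm X \<Omega> \<phi>.
        learning_objective nrm X \<Omega> \<phi> L lam xs ys f \<le> learning_objective nrm X \<Omega> \<phi> L lam xs ys g) \<and>
     (\<exists>\<mu> \<in> vector_measures nrm \<Omega>.
      \<exists>(\<omega> :: 'n \<times> 'd \<Rightarrow> real ^ 'dx) (b :: 'n \<times> 'd \<Rightarrow> real) (u :: 'n \<times> 'd \<Rightarrow> real ^ 'd)
       (U :: real ^ ('n \<times> 'd) ^ 'd) (W :: real ^ 'dx ^ ('n \<times> 'd)) (B :: real ^ ('n \<times> 'd)).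
        f = A_op X \<Omega> \<phi> \<mu> \<and>
        (\<forall>m. (\<omega> m, b m) \<in> \<Omega>) \<and>
        (\<forall>m. column m U = u m) \<and> (\<forall>m. row m W = \<omega> m) \<and> (\<forall>m. B $ m = b m) \<and>
        (\<forall>x\<in>X. f x = (\<Sum>m\<in>UNIV. \<sigma> (\<omega> m \<bullet> x + b m) *\<^sub>R u m)) \<and>
        (\<forall>x\<in>X. f x = U *v (\<chi> m. \<sigma> ((W *v x + B) $ m))))"
proof -
  have \<Omega>: "\<Omega> \<noteq> {}" using assms(3,5) by simp
  have C0: "C0_on \<Omega> (\<phi> x)" if "x \<in> X" for x using assms(10) that by (rule C0_on_slice)
  \<comment> \<open>Real-valued convex functions on a finite-dimensional space are
    continuous.\<close>
  have cont: "continuous_on UNIV (\<lambda>z. L z y)" for y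
    using assms(12)[of y] by (intro convex_on_continuous) auto
  obtain w :: "'n \<times> 'd \<Rightarrow> (real ^ 'dx) \<times> real" and v :: "'n \<times> 'd \<Rightarrow> real ^ 'd" where
    w: "\<And>m. w m \<in> \<Omega>" and min: "\<And>g. g \<in> vv_RKBS nrm X \<Omega> \<phi> \<Longrightarrow>
      learning_objective nrm X \<Omega> \<phi> L lam xs ys (A_op X \<Omega> \<phi> (atomic_vm w v)) \<le>
      learning_objective nrm X \<Omega> \<phi> L lam xs ys g"
    using atomic_minimizer_exists[of nrm \<Omega> X \<phi> xs L lam ys] assms(1,11,13,15) \<Omega> C0 cont by blast
  let ?\<mu> = "atomic_vm w v"
  let ?f = "A_op X \<Omega> \<phi> ?\<mu>"
  have \<mu>: "?\<mu> \<in> vector_measures nrm \<Omega>" by (rule atomic_vm_in_vector_measures[OF assms(1)])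
  \<comment> \<open>The factor \<open>\<beta> (w m)\<close> is independent of \<open>x\<close> and
    moves into the output weight.\<close>
  define u where "u m = \<beta> (w m) *\<^sub>R v m" for m
  have f: "?f x = (\<Sum>m\<in>UNIV. \<sigma> (fst (w m) \<bullet> x + snd (w m)) *\<^sub>R u m)" if x: "x \<in> X" for x
  proof -
    obtain M where M: "\<And>w. w \<in> \<Omega> \<Longrightarrow> \<bar>\<phi> x w\<bar> \<le> M"
      using C0_on_measurable_bounded(2)[OF C0[OF x]] by blast
    have \<phi>: "\<phi> x (w m) = \<sigma> (fst (w m) \<bullet> x + snd (w m)) * \<beta> (w m)" for m
      using assms(9)[OF x, of "fst (w m)" "snd (w m)"] w[of m] by simp
    have "?f x = (\<Sum>m\<in>UNIV. \<phi> x (w m) *\<^sub>R v m)"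
      using vm_integral_atomic_vm[OF assms(1) w C0_on_measurable_bounded(1)[OF C0[OF x]] M] x
      by (simp add: A_op_def)
    then show ?thesis by (simp add: u_def \<phi>)
  qed
  let ?U = "\<chi> i m. u m $ i" and ?W = "\<chi> m. fst (w m)" and ?B = "\<chi> m. snd (w m)"
  have "?f x = ?U *v (\<chi> m. \<sigma> ((?W *v x + ?B) $ m))" if "x \<in> X" for x
    by (simp add: f[OF that] vec_eq_iff matrix_vector_mult_def inner_vec_def mult.commute)
  then show ?thesis
    using \<mu> min w f
    by (intro bexI[of _ ?f] conjI ballI bexI[of _ ?\<mu>] exI[of _ "\<lambda>m. fst (w m)"]
        exI[of _ "\<lambda>m. snd (w m)"] exI[of _ u] exI[of _ ?U] exI[of _ ?W] exI[of _ ?B])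
      (auto simp: column_def row_def vec_eq_iff vv_RKBS_def)
qed

end
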